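(* Let $G$ be an undirected connected graph on $\{1,\dots,n\}$, let $f_1,\dots,f_n:\mathbb{R}\to\mathbb{R}$ be convex functions, and let $f(\theta)=\frac1n\sum_{i=1}^n f_i(\theta)$. Suppose that $U\ge n$ and $U=\Theta(n)$, that $w^*$ is a global minimizer of $f$, and that the absolute value of all subgradients of all $f_i$ is bounded by a constant $L>0$. Let $T\ge 1$ be an integer and $\beta=\frac{1}{L\sqrt{UT}}$. Starting from arbitrary real $x_i(1)$ with $y_i(1)=z_i(1)=x_i(1)$, suppose every node $i$ updates $$y_i(t+1)=x_i(t)+\frac12\sum_{j\in N(i)}\frac{x_j(t)-x_i(t)}{\max(d(i),d(j))}-\beta g_i(t),$$ $$z_i(t+1)=y_i(t)-\beta g_i(t),$$ $$x_i(t+1)=y_i(t+1)+\left(1-\frac{2}{9U+1}\right)\left(y_i(t+1)-z_i(t+1)\right),$$ where $g_i(t)$ is a subgradient of $f_i$ at $y_i(t)$. Then $$\mathrm{Disp}(\widehat y_1(T),\dots,\widehat y_n(T))=O\left(\sqrt{\frac nT}\left(\frac{\|\mathbf{y}(1)-\overline{x}\mathbf{1}\|_2}{\sqrt T}+1\right)\right),$$ $$\mathrm{Err}(\widehat y_1(T),\dots,\widehat y_n(T))=O\left(L\sqrt{\frac nT}\left(\frac{\|\mathbf{y}(1)-\overline{x}\mathbf{1}\|_2}{\sqrt T}+1+(\overline{x}-w^* )^2\right)\right).$$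
   Context: $N(i)$ is the set of neighbors of node $i$ in $G$ (with $i\notin N(i)$) and $d(i)$ is the degree of $i$. $\mathbf{y}(t)=(y_1(t),\dots,y_n(t))^T$, $\mathbf{1}$ is the all-ones vector in $\mathbb{R}^n$, $\overline{x}=\frac1n\sum_{j=1}^n x_j(1)$, and $\widehat y_i(T)=\frac1T\sum_{k=1}^T y_i(k)$. For real numbers $\theta_1,\dots,\theta_n$, $$\mathrm{Disp}(\theta_1,\dots,\theta_n)=\frac1n\sum_{i=1}^n|\theta_i-\mathrm{median}(\theta_1,\dots,\theta_n)|,\qquad \mathrm{Err}(\theta_1,\dots,\theta_n)=\left(\frac1n\sum_{i=1}^n f_i(\theta_i)\right)-f(w^* ).$$ $U=\Theta(n)$ means $U\le cn$ for a constant $c$ independent of $n$ (together with $U\ge n$). The constants hidden in $O(\cdot)$ depend only on $c$; they do not depend on $n$, $T$, $L$, the graph, the functions $f_i$, the initial values, or $w^*$. *)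

theory Defs
  imports "HOL-Analysis.Analysis" "Graph_Theory.Graph_Theory"
begin

text \<open>
  An undirected graph on \<open>{1..n}\<close> is a \<open>pair_graph\<close> (finite, symmetric, loop-free, no parallel
  arcs) with vertex set \<open>{1..n}\<close>.  A vector in \<open>\<real>\<^sup>n\<close> is a function \<open>nat \<Rightarrow> real\<close> of which only the
  values on \<open>{1..n}\<close> matter, since \<open>n\<close> is quantified inside the statement.  For an iterate \<open>y\<close>,
  \<open>y t i\<close> is the value of node \<open>i\<close> at time \<open>t\<close>, with time starting at \<open>1\<close>.
\<close>

definition neighbors :: "'a pair_pre_digraph \<Rightarrow> 'a \<Rightarrow> 'a set" where
  "neighbors G i = {j. (i, j) \<in> parcs G}"

definition degree :: "'a pair_pre_digraph \<Rightarrow> 'a \<Rightarrow> nat" where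
  "degree G i = card (neighbors G i)"

definition is_subgradient :: "(real \<Rightarrow> real) \<Rightarrow> real \<Rightarrow> real \<Rightarrow> bool" where
  "is_subgradient f \<theta> s \<longleftrightarrow> (\<forall>u. f u \<ge> f \<theta> + s * (u - \<theta>))"

definition accelerated_subgradient_run ::
  "nat pair_pre_digraph \<Rightarrow> (nat \<Rightarrow> real \<Rightarrow> real) \<Rightarrow> real \<Rightarrow> real \<Rightarrow>
   (nat \<Rightarrow> nat \<Rightarrow> real) \<Rightarrow> (nat \<Rightarrow> nat \<Rightarrow> real) \<Rightarrow> (nat \<Rightarrow> nat \<Rightarrow> real) \<Rightarrow> (nat \<Rightarrow> nat \<Rightarrow> real) \<Rightarrow> bool"
where
  "accelerated_subgradient_run G f U \<beta> x y z g \<longleftrightarrow>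
     (\<forall>i\<in>pverts G. y 1 i = x 1 i \<and> z 1 i = x 1 i) \<and>
     (\<forall>t\<ge>1. \<forall>i\<in>pverts G.
        is_subgradient (f i) (y t i) (g t i) \<and>
        y (t + 1) i =
          x t i
          + 1/2 * (\<Sum>j\<in>neighbors G i.
                     (x t j - x t i) / real (max (degree G i) (degree G j)))
          - \<beta> * g t i \<and>
        z (t + 1) i = y t i - \<beta> * g t i \<and>
        x (t + 1) i =
          y (t + 1) i + (1 - 2 / (9 * U + 1)) * (y (t + 1) i - z (t + 1) i))"

definition average :: "nat \<Rightarrow> (nat \<Rightarrow> real) \<Rightarrow> real" where
  "average n \<theta> = (\<Sum>i=1..n. \<theta> i) / real n"

definition average_function :: "nat \<Rightarrow> (nat \<Rightarrow> real \<Rightarrow> real) \<Rightarrow> real \<Rightarrow> real" where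
  "average_function n f \<theta> = (\<Sum>i=1..n. f i \<theta>) / real n"

definition time_average :: "nat \<Rightarrow> (nat \<Rightarrow> nat \<Rightarrow> real) \<Rightarrow> nat \<Rightarrow> real" where
  "time_average T y i = (\<Sum>k=1..T. y k i) / real T"

text \<open>
  The two indices coincide for odd \<open>n\<close>; for even \<open>n\<close> the median is the midpoint of the two
  central order statistics.  (\<open>disp\<close> below has the same value for every point between them.)
\<close>

definition median :: "nat \<Rightarrow> (nat \<Rightarrow> real) \<Rightarrow> real" where
  "median n \<theta> =
     (let s = sort (map \<theta> [1..<n+1]) in (s ! ((n - 1) div 2) + s ! (n div 2)) / 2)"

definition disp :: "nat \<Rightarrow> (nat \<Rightarrow> real) \<Rightarrow> real" where
  "disp n \<theta> = (\<Sum>i=1..n. \<bar>\<theta> i - median n \<theta>\<bar>) / real n"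

definition err :: "nat \<Rightarrow> (nat \<Rightarrow> real \<Rightarrow> real) \<Rightarrow> real \<Rightarrow> (nat \<Rightarrow> real) \<Rightarrow> real" where
  "err n f w \<theta> = (\<Sum>i=1..n. f i (\<theta> i)) / real n - average_function n f w"

end

theory Submission
  imports Defs
begin

text \<open>
Let \<open>W\<close> be the lazy Metropolis averaging step and \<open>A = I - W\<close>.  Averaged over the nodes, the three
update rules collapse to a plain subgradient step \<open>m\<^sub>t\<^sub>+\<^sub>1 = m\<^sub>t - \<beta> \<gamma>\<^sub>t\<close>, where \<open>\<gamma>\<^sub>t\<close> is the mean of the
subgradients used at time \<open>t\<close>.  So the theorem splits into two questions: how far the nodes are
from their mean, and how well a subgradient method performs when its subgradients are taken at
points slightly away from the iterate.

Disagreement.  The noise enters \<open>y\<close> and \<open>x\<close> equally, so it cancels from the update of the momentum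
\<open>x - y\<close>, which has the form \<open>A p\<close> with \<open>p\<close> driven by \<open>p' = \<sigma> (W p - y)\<close>.  In the variables \<open>(y, p)\<close>, with \<open>y\<close> centred at its
mean, one free step multiplies the component of the quadratic form
\<open>R(y, p) = \<sigma> \<langle>y, y\<rangle> + (1 - \<sigma>) \<langle>W y, p\<rangle> + \<langle>W p, A p\<rangle>\<close> belonging to an eigenvalue \<open>\<lambda>\<close> of \<open>W\<close> by exactly \<open>\<sigma> \<lambda>\<close>.
Hence \<open>R\<close> shrinks by the factor \<open>\<sigma>\<close> (lemma \<open>energy_step\<close>), while \<open>R\<close> is at least \<open>\<sigma> / 2\<close> times \<open>\<langle>y, y\<rangle>\<close>
(lemma \<open>energy_ge\<close>); both need the spectral gap \<open>\<delta>\<close> of \<open>W\<close> only through \<open>(1 - \<sigma>)\<^sup>2 \<le> 2 \<sigma> \<delta>\<close>.  So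
although the gap can be as small as order \<open>1 / n\<^sup>2\<close>, the disagreement contracts at rate \<open>1 - \<Theta>(1 / n)\<close>.  Since
\<open>sqrt R\<close> is a seminorm, noise of norm \<open>\<beta> L sqrt n\<close> per step is absorbed additively, and summing over
time gives a total disagreement of order \<open>n (D + T \<beta> L sqrt n)\<close> (lemmas \<open>sum_norm_perturbed_run_le\<close>
and \<open>sum_norm_deviation_le\<close>), where \<open>D\<close> is the initial one.

Spectral gap.  A vertex is adjacent to at most three vertices of a shortest path, so the degrees along
a shortest path sum to at most \<open>3 n\<close>.  Cauchy-Schwarz along the path therefore bounds
\<open>(u\<^sub>a - u\<^sub>b)\<^sup>2\<close> by \<open>6 n\<close> times the Dirichlet form of the Metropolis weights, and summing over all pairs
of vertices gives a gap of at least \<open>1 / (12 n\<^sup>2)\<close> (lemma \<open>poincare\<close>).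

Optimization.  The usual telescoping of \<open>(m\<^sub>t - w)\<^sup>2\<close> bounds the average excess of
\<open>(\<Sum>i. f\<^sub>i (y\<^sub>i)) / n\<close> by a term of the form \<open>(m\<^sub>1 - w)\<^sup>2 / (2 \<beta> T) + \<beta> L\<^sup>2 / 2\<close> plus \<open>L\<close> times the mean
disagreement (lemma \<open>err_le\<close>), and Jensen's inequality passes to the time averages.  In the other direction,
the error is at least \<open>-L\<close> times the disagreement (lemma \<open>err_ge\<close>), because \<open>w\<close> is a minimizer.  The
dispersion is itself at most the mean disagreement, since the median minimizes the mean absolute
distance (lemma \<open>disp_le\<close>).
\<close>

section \<open>The median as a minimizer\<close>

text \<open>
Pair the \<open>k\<close>-th smallest entry with the \<open>k\<close>-th largest.  The median lies between them, so the two
distances to it add up to the length of the interval they span; for any other point \<open>a\<close> the sum is at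
least that length.
\<close>
lemma sum_list_abs_median_le:
  fixes s :: "real list"
  assumes "sorted s" "s \<noteq> []"
  defines "m \<equiv> (s ! ((length s - 1) div 2) + s ! (length s div 2)) / 2"
  shows "(\<Sum>x\<leftarrow>s. \<bar>x - m\<bar>) \<le> (\<Sum>x\<leftarrow>s. \<bar>x - a\<bar>)"
proof -
  let ?n = "length s"
  \<comment> \<open>Counting each entry once in its own place and once as a mirror image makes all pairs appear twice.\<close>
  have twice: "2 * (\<Sum>x\<leftarrow>s. \<bar>x - b\<bar>) = (\<Sum>k<?n. \<bar>s ! k - b\<bar> + \<bar>s ! (?n - 1 - k) - b\<bar>)" for b
  proof -
    have "(\<Sum>x\<leftarrow>s. \<bar>x - b\<bar>) = (\<Sum>k<?n. \<bar>s ! k - b\<bar>)"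
      by (simp add: sum_list_sum_nth atLeast0LessThan)
    moreover have "(\<Sum>k<?n. \<bar>s ! k - b\<bar>) = (\<Sum>k<?n. \<bar>s ! (?n - 1 - k) - b\<bar>)"
      using sum.nat_diff_reindex[of "\<lambda>k. \<bar>s ! k - b\<bar>" ?n] by simp
    ultimately show ?thesis by (simp add: sum.distrib)
  qed
  have between: "s ! k \<le> m \<and> m \<le> s ! (?n - 1 - k)" if "k < ?n" "k \<le> ?n - 1 - k" for k
  proof -
    have "s ! k \<le> s ! ((?n - 1) div 2)" "s ! k \<le> s ! (?n div 2)"
      "s ! ((?n - 1) div 2) \<le> s ! (?n - 1 - k)" "s ! (?n div 2) \<le> s ! (?n - 1 - k)"
      using that by (auto intro!: sorted_nth_mono[OF assms(1)])
    moreover have "x \<le> (p + q) / 2 \<and> (p + q) / 2 \<le> z"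
      if "x \<le> p" "x \<le> q" "p \<le> z" "q \<le> z" for x p q z :: real
      using that by (simp add: field_simps)
    ultimately show ?thesis unfolding m_def by blast
  qed
  have pair: "\<bar>x - m\<bar> + \<bar>z - m\<bar> \<le> \<bar>x - a\<bar> + \<bar>z - a\<bar>" if "x \<le> m \<and> m \<le> z" for x z
    using that by (elim conjE) linarith
  have "\<bar>s ! k - m\<bar> + \<bar>s ! (?n - 1 - k) - m\<bar> \<le> \<bar>s ! k - a\<bar> + \<bar>s ! (?n - 1 - k) - a\<bar>" if "k < ?n" for k
  proof (cases "k \<le> ?n - 1 - k")
    case True
    then show ?thesis using between[OF that] by (intro pair)
  next
    case False
    then have "?n - 1 - k < ?n" "?n - 1 - k \<le> ?n - 1 - (?n - 1 - k)" "?n - 1 - (?n - 1 - k) = k"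
      using that by auto
    then show ?thesis using pair[OF between[of "?n - 1 - k"]] by (simp only: add.commute)
  qed
  then have "2 * (\<Sum>x\<leftarrow>s. \<bar>x - m\<bar>) \<le> 2 * (\<Sum>x\<leftarrow>s. \<bar>x - a\<bar>)"
    unfolding twice by (intro sum_mono) simp
  then show ?thesis by simp
qed

lemma disp_le:
  assumes "0 < n"
  shows "disp n \<theta> \<le> (\<Sum>i=1..n. \<bar>\<theta> i - a\<bar>) / real n"
proof -
  define s where "s = sort (map \<theta> [1..<n+1])"
  have len: "length s = n" and "s \<noteq> []"
    using assms by (auto simp: s_def simp flip: length_0_conv)
  have sum_s: "(\<Sum>x\<leftarrow>s. F x) = (\<Sum>i=1..n. F (\<theta> i))" for F :: "real \<Rightarrow> real"
  proof -
    have "(\<Sum>x\<leftarrow>s. F x) = sum_mset (image_mset F (mset s))"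
      by (simp flip: sum_mset_sum_list)
    also have "\<dots> = sum_list (map F (map \<theta> [1..<n+1]))"
      by (simp only: s_def mset_sort flip: sum_mset_sum_list mset_map)
    also have "\<dots> = (\<Sum>i\<in>set [1..<n+1]. F (\<theta> i))"
      by (simp only: map_map sum_list_distinct_conv_sum_set distinct_upt o_def)
    also have "\<dots> = (\<Sum>i=1..n. F (\<theta> i))"
      by (rule sum.cong) auto
    finally show ?thesis .
  qed
  have "median n \<theta> = (s ! ((length s - 1) div 2) + s ! (length s div 2)) / 2"
    by (simp only: median_def Let_def len s_def[symmetric])
  moreover have "sorted s" by (simp only: s_def sorted_sort)
  ultimately have "(\<Sum>x\<leftarrow>s. \<bar>x - median n \<theta>\<bar>) \<le> (\<Sum>x\<leftarrow>s. \<bar>x - a\<bar>)"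
    using sum_list_abs_median_le[OF _ \<open>s \<noteq> []\<close>] by (simp only:)
  then show ?thesis
    unfolding sum_s disp_def by (simp add: divide_right_mono)
qed

section \<open>Convex functions with bounded subgradients\<close>

lemma convex_on_subgradient_exists:
  assumes "convex_on UNIV f"
  obtains s where "is_subgradient f \<theta> s"
  using convex_le_Inf_differential[OF assms, of \<theta>] by (auto simp: is_subgradient_def)

lemma jensen_uniform:
  fixes F :: "real \<Rightarrow> real"
  assumes "convex_on UNIV F" "1 \<le> T"
  shows "F ((\<Sum>k=1..T. v k) / real T) \<le> (\<Sum>k=1..T. F (v k)) / real T"
proof -
  have "F (\<Sum>k=1..T. (1 / real T) *\<^sub>R v k) \<le> (\<Sum>k=1..T. (1 / real T) * F (v k))"
    using assms by (intro convex_on_sum) auto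
  then show ?thesis by (simp add: sum_divide_distrib)
qed

text \<open>
The error of a scattered point can be negative, because each \<open>f i\<close> is evaluated at its own argument.
Moving all arguments to a common \<open>a\<close> costs at most \<open>L\<close> per unit of distance, and there the average
cannot undercut its minimum.
\<close>
lemma err_ge:
  assumes "\<And>i. i \<in> {1..n} \<Longrightarrow> convex_on UNIV (f i)"
    and L: "\<And>i \<theta> s. i \<in> {1..n} \<Longrightarrow> is_subgradient (f i) \<theta> s \<Longrightarrow> \<bar>s\<bar> \<le> L"
    and min: "\<And>\<theta>. average_function n f w \<le> average_function n f \<theta>"
  shows "- (L * ((\<Sum>i=1..n. \<bar>\<theta> i - a\<bar>) / real n)) \<le> err n f w \<theta>"
proof -
  have "f i a - L * \<bar>\<theta> i - a\<bar> \<le> f i (\<theta> i)" if i: "i \<in> {1..n}" for i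
  proof -
    obtain s where s: "is_subgradient (f i) a s"
      using convex_on_subgradient_exists[OF assms(1)[OF i]] .
    have "- (L * \<bar>\<theta> i - a\<bar>) \<le> - (\<bar>s\<bar> * \<bar>\<theta> i - a\<bar>)"
      using L[OF i s] by (simp add: mult_right_mono)
    also have "\<dots> \<le> s * (\<theta> i - a)"
      by (metis abs_ge_minus_self abs_mult minus_le_iff)
    finally show ?thesis using s by (auto simp: is_subgradient_def dest: spec[of _ "\<theta> i"])
  qed
  then have "(\<Sum>i=1..n. f i a - L * \<bar>\<theta> i - a\<bar>) / real n \<le> (\<Sum>i=1..n. f i (\<theta> i)) / real n"
    by (intro divide_right_mono sum_mono) auto
  then show ?thesis
    using min[of a] unfolding err_def average_function_def
    by (simp add: sum_subtractf sum_distrib_left diff_divide_distrib)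
qed

section \<open>Accelerated averaging with a self-adjoint operator\<close>

text \<open>
Vectors are functions of which only the values on \<open>V\<close> count, so that the dimension can vary inside a
statement; the semi-inner product is therefore relative to \<open>V\<close>.
\<close>
definition inner_on :: "'a set \<Rightarrow> ('a \<Rightarrow> real) \<Rightarrow> ('a \<Rightarrow> real) \<Rightarrow> real" where
  "inner_on V a b = (\<Sum>i\<in>V. a i * b i)"

lemma inner_on_commute: "inner_on V a b = inner_on V b a"
  by (simp add: inner_on_def mult.commute)

lemma inner_on_linear_left:
  "inner_on V (\<lambda>i. a i + b i) d = inner_on V a d + inner_on V b d"
  "inner_on V (\<lambda>i. a i - b i) d = inner_on V a d - inner_on V b d"
  "inner_on V (\<lambda>i. c * a i) d = c * inner_on V a d"
  by (simp_all add: inner_on_def sum.distrib sum_subtractf sum_distrib_left algebra_simps)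

lemma inner_on_linear_right:
  "inner_on V d (\<lambda>i. a i + b i) = inner_on V d a + inner_on V d b"
  "inner_on V d (\<lambda>i. a i - b i) = inner_on V d a - inner_on V d b"
  "inner_on V d (\<lambda>i. c * a i) = c * inner_on V d a"
  by (simp_all add: inner_on_def sum.distrib sum_subtractf sum_distrib_left algebra_simps)

lemma inner_on_zero_left: "inner_on V (\<lambda>i. 0) d = 0"
  by (simp add: inner_on_def)

lemmas inner_on_linear = inner_on_linear_left inner_on_linear_right

lemma inner_on_nonneg: "0 \<le> inner_on V a a"
  by (simp add: inner_on_def sum_nonneg)

lemma inner_on_cong:
  "(\<And>i. i \<in> V \<Longrightarrow> a i = a' i) \<Longrightarrow> (\<And>i. i \<in> V \<Longrightarrow> b i = b' i) \<Longrightarrow> inner_on V a b = inner_on V a' b'"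
  by (simp add: inner_on_def)

lemma abs_inner_on_le: "\<bar>inner_on V a b\<bar> \<le> sqrt (inner_on V a a) * sqrt (inner_on V b b)"
proof -
  have "\<bar>inner_on V a b\<bar> \<le> (\<Sum>i\<in>V. \<bar>a i\<bar> * \<bar>b i\<bar>)"
    unfolding inner_on_def by (rule order_trans[OF sum_abs]) (simp add: abs_mult)
  also have "\<dots> \<le> L2_set a V * L2_set b V"
    by (rule L2_set_mult_ineq)
  finally show ?thesis by (simp add: L2_set_def inner_on_def power2_eq_square)
qed

text \<open>
A quadratic form in two vectors with nonpositive discriminant, where \<open>r\<close> and \<open>s\<close> are the squared
norms and \<open>q\<close> is the inner product.
\<close>
lemma quadratic_nonneg:
  fixes a b d q r s :: real
  assumes "0 \<le> a" "0 \<le> d" "b\<^sup>2 \<le> 4 * a * d" "\<bar>q\<bar> \<le> sqrt r * sqrt s" "0 \<le> r" "0 \<le> s" "0 \<le> b"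
  shows "0 \<le> a * r + b * q + d * s"
proof -
  have "b = sqrt (b\<^sup>2)" using assms by simp
  also have "\<dots> \<le> sqrt (4 * a * d)" using assms(3) real_sqrt_le_iff by blast
  also have "\<dots> = 2 * (sqrt a * sqrt d)" by (simp add: real_sqrt_mult)
  finally have "b * \<bar>q\<bar> \<le> 2 * (sqrt a * sqrt d) * (sqrt r * sqrt s)"
    using assms by (intro mult_mono) auto
  moreover have "0 \<le> (sqrt a * sqrt r - sqrt d * sqrt s)\<^sup>2" by simp
  then have "2 * (sqrt a * sqrt d) * (sqrt r * sqrt s) \<le> a * r + d * s"
    using assms by (simp add: power2_diff power_mult_distrib algebra_simps)
  moreover have "- (b * \<bar>q\<bar>) \<le> b * q" using assms(7)
    by (metis abs_le_iff abs_mult abs_of_nonneg minus_le_iff order_refl)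
  ultimately show ?thesis by linarith
qed

text \<open>
On the vectors of sum zero, the spectrum of \<open>W\<close> lies in \<open>[0, 1 - \<delta>]\<close>.
\<close>
locale consensus_operator =
  fixes V :: "'a set" and W :: "('a \<Rightarrow> real) \<Rightarrow> 'a \<Rightarrow> real" and \<delta> :: real
  assumes locality: "(\<And>i. i \<in> V \<Longrightarrow> a i = b i) \<Longrightarrow> i \<in> V \<Longrightarrow> W a i = W b i"
    and linear: "W (\<lambda>i. a i + c * b i) = (\<lambda>i. W a i + c * W b i)"
    and self_adjoint: "inner_on V (W a) b = inner_on V a (W b)"
    and positive: "0 \<le> inner_on V a (W a)"
    and preserves_sum: "sum (W a) V = sum a V"
    and gap: "sum a V = 0 \<Longrightarrow> \<delta> * inner_on V a a \<le> inner_on V a a - inner_on V a (W a)"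
    and gap_pos: "0 < \<delta>"
begin

lemma W_zero: "W (\<lambda>i. 0) = (\<lambda>i. 0)"
  using linear[of "\<lambda>i. 0" "-1" "\<lambda>i. 0"] by simp

lemma W_linear:
  "W (\<lambda>i. a i + b i) = (\<lambda>i. W a i + W b i)"
  "W (\<lambda>i. a i - b i) = (\<lambda>i. W a i - W b i)"
  "W (\<lambda>i. c * a i) = (\<lambda>i. c * W a i)"
  using linear[of a 1 b] linear[of a "-1" b] linear[of "\<lambda>i. 0" c a] by (simp_all add: W_zero)

definition A :: "('a \<Rightarrow> real) \<Rightarrow> 'a \<Rightarrow> real" where
  "A a = (\<lambda>i. a i - W a i)"

lemma sum_A: "sum (A a) V = 0"
  by (simp add: A_def sum_subtractf preserves_sum)

text \<open>
Rewriting with these rules brings every quadratic form in polynomials of \<open>W\<close> into a linear combination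
of the moments \<open>inner_on V a (W (\<dots> (W b)))\<close>, so that identities between such forms become
identities of polynomials.
\<close>
lemmas normalize = A_def W_linear inner_on_linear self_adjoint

text \<open>
For an eigenvalue \<open>\<lambda>\<close> of \<open>W\<close> the free recursion \<open>y\<^sub>t\<^sub>+\<^sub>2 = \<lambda> (1 + \<sigma>) y\<^sub>t\<^sub>+\<^sub>1 - \<lambda> \<sigma> y\<^sub>t\<close> multiplies
\<open>y\<^sub>t\<^sub>+\<^sub>1\<^sup>2 - \<lambda> (1 + \<sigma>) y\<^sub>t\<^sub>+\<^sub>1 y\<^sub>t + \<lambda> \<sigma> y\<^sub>t\<^sup>2\<close> by the product \<open>\<lambda> \<sigma>\<close> of its characteristic roots.  Substituting
\<open>y\<^sub>t\<^sub>+\<^sub>1 = \<lambda> (y + (1 - \<lambda>) p)\<close> makes this form divisible by \<open>\<lambda> (1 - \<lambda>)\<close>, and the quotient is the form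
below.  Without the division by \<open>1 - \<lambda>\<close> it would control the disagreement only in the degenerate
norm \<open>\<langle>y, A y\<rangle>\<close>.
\<close>
definition energy :: "real \<Rightarrow> ('a \<Rightarrow> real) \<Rightarrow> ('a \<Rightarrow> real) \<Rightarrow> real" where
  "energy \<sigma> y p = \<sigma> * inner_on V y y + (1 - \<sigma>) * inner_on V (W y) p + inner_on V (W p) (A p)"

lemma energy_cong:
  assumes "\<And>i. i \<in> V \<Longrightarrow> y i = y' i"
  shows "energy \<sigma> y p = energy \<sigma> y' p"
  unfolding energy_def using assms locality[OF assms] by (simp cong: inner_on_cong)

text \<open>
This is \<open>\<lambda> (1 - \<lambda>) \<ge> \<delta> \<lambda>\<^sup>2\<close> on the spectrum.  Products of commuting positive operators are positive, and
here no square root is needed to see it: \<open>W + A = I\<close> gives \<open>W A = W A W + A W A\<close>, where the first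
operator is at least \<open>\<delta> W W\<close> by the gap and the second is visibly positive.
\<close>
lemma WA_ge:
  assumes "sum p V = 0"
  shows "\<delta> * inner_on V (W p) (W p) \<le> inner_on V (W p) (A p)"
proof -
  \<comment> \<open>The two summands are the quadratic forms of \<open>W A W\<close> and \<open>A W A\<close>.\<close>
  have "inner_on V (W p) (A p) = inner_on V (W p) (A (W p)) + inner_on V (A p) (W (A p))"
    by (simp add: normalize)
  moreover have "\<delta> * inner_on V (W p) (W p) \<le> inner_on V (W p) (A (W p))"
    using gap[of "W p"] assms by (simp add: preserves_sum normalize)
  ultimately show ?thesis using positive[of "A p"] by simp
qed

text \<open>
After giving up half of \<open>\<sigma> \<langle>y, y\<rangle>\<close> and bounding \<open>\<langle>W p, A p\<rangle>\<close> by \<open>WA_ge\<close>, the remaining form in \<open>y\<close> and \<open>W p\<close> still has nonpositive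
discriminant, which is the condition relating \<open>\<sigma>\<close> and \<open>\<delta>\<close>.
\<close>
lemma energy_ge:
  assumes "sum p V = 0" "0 \<le> \<sigma>" "\<sigma> \<le> 1" "(1 - \<sigma>)\<^sup>2 \<le> 2 * \<sigma> * \<delta>"
  shows "\<sigma> / 2 * inner_on V y y \<le> energy \<sigma> y p"
proof -
  have "0 \<le> \<sigma> / 2 * inner_on V y y + (1 - \<sigma>) * inner_on V y (W p) + \<delta> * inner_on V (W p) (W p)"
    using assms gap_pos by (intro quadratic_nonneg abs_inner_on_le inner_on_nonneg) auto
  then show ?thesis
    using WA_ge[OF assms(1)] by (simp add: energy_def self_adjoint)
qed

lemma energy_nonneg:
  assumes "sum p V = 0" "0 \<le> \<sigma>" "\<sigma> \<le> 1" "(1 - \<sigma>)\<^sup>2 \<le> 2 * \<sigma> * \<delta>"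
  shows "0 \<le> energy \<sigma> y p"
proof -
  have "0 \<le> \<sigma> / 2 * inner_on V y y"
    using assms(2) inner_on_nonneg by (intro mult_nonneg_nonneg) auto
  then show ?thesis using energy_ge[OF assms, of y] by linarith
qed

text \<open>
On the component of eigenvalue \<open>\<lambda>\<close> the new energy is \<open>\<sigma> \<lambda>\<close> times the old one, so the loss
\<open>\<sigma> R - R'\<close> is \<open>\<sigma>\<close> times the energy weighted with \<open>A\<close>.  That weighted form is nonnegative by the same
discriminant condition, now using the gap for \<open>\<langle>y, A y\<rangle>\<close>.
\<close>
lemma energy_step:
  assumes "sum y V = 0" "0 \<le> \<sigma>" "\<sigma> \<le> 1" "(1 - \<sigma>)\<^sup>2 \<le> 2 * \<sigma> * \<delta>"
  shows "energy \<sigma> (W (\<lambda>i. y i + A p i)) (\<lambda>i. \<sigma> * (W p i - y i)) \<le> \<sigma> * energy \<sigma> y p"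
proof -
  define m where "m = A p"
  \<comment> \<open>Self-adjointness identifies the mixed moments; with them on one side the identity is polynomial.\<close>
  have sw: "inner_on V p y = inner_on V y p" "inner_on V p (W y) = inner_on V y (W p)"
    "inner_on V p (W (W y)) = inner_on V y (W (W p))"
    "inner_on V p (W (W (W y))) = inner_on V y (W (W (W p)))"
    by (metis inner_on_commute self_adjoint)+
  have "\<sigma> * energy \<sigma> y p - energy \<sigma> (W (\<lambda>i. y i + A p i)) (\<lambda>i. \<sigma> * (W p i - y i))
      = \<sigma> * (\<sigma> * inner_on V y (A y) + (1 - \<sigma>) * inner_on V y (W m) + inner_on V m (W m))"
    unfolding m_def energy_def by (simp add: normalize sw) (simp add: sw algebra_simps)
  moreover have "0 \<le> \<sigma> * inner_on V y (A y) + (1 - \<sigma>) * inner_on V y (W m) + inner_on V m (W m)"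
  proof -
    have "0 \<le> \<sigma> * \<delta> * inner_on V y y + (1 - \<sigma>) * inner_on V y (W m) + 1 * inner_on V (W m) (W m)"
    proof (intro quadratic_nonneg abs_inner_on_le inner_on_nonneg)
      show "(1 - \<sigma>)\<^sup>2 \<le> 4 * (\<sigma> * \<delta>) * 1"
        using assms gap_pos mult_nonneg_nonneg[of \<sigma> \<delta>] by (auto intro: order_trans)
    qed (use assms gap_pos in auto)
    moreover have "\<sigma> * (\<delta> * inner_on V y y) \<le> \<sigma> * inner_on V y (A y)"
      using gap[OF assms(1)] assms by (intro mult_left_mono) (auto simp: normalize)
    moreover have "0 \<le> inner_on V (W m) (A m)"
      using WA_ge[of m] mult_nonneg_nonneg[OF less_imp_le[OF gap_pos] inner_on_nonneg[of V "W m"]]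
      by (simp add: m_def sum_A)
    then have "inner_on V (W m) (W m) \<le> inner_on V m (W m)"
      by (simp add: normalize)
    ultimately show ?thesis by (simp add: algebra_simps)
  qed
  ultimately have "0 \<le> \<sigma> * energy \<sigma> y p - energy \<sigma> (W (\<lambda>i. y i + A p i)) (\<lambda>i. \<sigma> * (W p i - y i))"
    using assms(2) by (simp only: mult_nonneg_nonneg)
  then show ?thesis by simp
qed

text \<open>
The triangle inequality for the seminorm \<open>sqrt (energy \<sigma>)\<close>, with a perturbation \<open>(h, 0)\<close> of energy
\<open>\<sigma> \<langle>h, h\<rangle>\<close>.  As for every positive quadratic form, it comes from the discriminant of
\<open>c \<mapsto> energy \<sigma> (y + c h) p\<close>.
\<close>
lemma energy_perturb:
  assumes "sum p V = 0" "0 \<le> \<sigma>" "\<sigma> \<le> 1" "(1 - \<sigma>)\<^sup>2 \<le> 2 * \<sigma> * \<delta>"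
  shows "sqrt (energy \<sigma> (\<lambda>i. y i + h i) p) \<le> sqrt (energy \<sigma> y p) + sqrt \<sigma> * sqrt (inner_on V h h)"
proof -
  define E where "E = energy \<sigma> y p"
  define k where "k = 2 * \<sigma> * inner_on V y h + (1 - \<sigma>) * inner_on V h (W p)"
  define H where "H = \<sigma> * inner_on V h h"
  have expand: "energy \<sigma> (\<lambda>i. y i + c * h i) p = E + c * k + c\<^sup>2 * H" for c
    unfolding E_def k_def H_def energy_def
    by (simp add: normalize inner_on_commute[of V h y] power2_eq_square) (simp add: algebra_simps)
  have nonneg: "0 \<le> E + c * k + c\<^sup>2 * H" for c
    unfolding expand[symmetric] by (rule energy_nonneg[OF assms])
  have "E \<ge> 0" using nonneg[of 0] by simp
  have "H \<ge> 0" unfolding H_def using assms(2) inner_on_nonneg by (intro mult_nonneg_nonneg)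
  have "k \<le> 2 * (sqrt E * sqrt H)"
  proof (cases "H = 0 \<or> k \<le> 0")
    case True
    have "k \<le> 0" if "H = 0"
    proof (rule ccontr)
      assume "\<not> k \<le> 0"
      \<comment> \<open>With \<open>H = 0\<close> the polynomial is affine in \<open>c\<close>; here it takes the value \<open>-1\<close>.\<close>
      then show False using nonneg[of "-(E + 1) / k"] that by (simp add: field_simps)
    qed
    then have "k \<le> 0" using True by blast
    moreover have "0 \<le> sqrt E * sqrt H" using \<open>E \<ge> 0\<close> \<open>H \<ge> 0\<close> by simp
    ultimately show ?thesis by linarith
  next
    case False
    then have "H > 0" using \<open>H \<ge> 0\<close> by simp
    \<comment> \<open>The polynomial is evaluated at its vertex.\<close>
    have "k\<^sup>2 \<le> 4 * E * H"
      using nonneg[of "- k / (2 * H)"] \<open>H > 0\<close> by (simp add: field_simps power2_eq_square)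
    then have "k \<le> sqrt (4 * E * H)" by (rule real_le_rsqrt)
    then show ?thesis by (simp add: real_sqrt_mult)
  qed
  then have "E + k + H \<le> (sqrt E + sqrt H)\<^sup>2"
    using \<open>E \<ge> 0\<close> \<open>H \<ge> 0\<close> by (simp add: power2_sum)
  then have "sqrt (E + k + H) \<le> sqrt E + sqrt H"
    using \<open>E \<ge> 0\<close> \<open>H \<ge> 0\<close> by (intro real_le_lsqrt) auto
  then show ?thesis
    using expand[of 1] by (simp add: E_def[symmetric] H_def real_sqrt_mult)
qed

text \<open>
With \<open>s t = sqrt (energy \<sigma> (y t) (p t))\<close>, a step satisfies \<open>s (t + 1) \<le> sqrt \<sigma> (s t + B)\<close>.  Summing this
recursion over time, instead of solving it, bounds \<open>(1 - sqrt \<sigma>) (\<Sum>t<T. s t)\<close> directly, and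
\<open>1 - sqrt \<sigma> \<ge> (1 - \<sigma>) / 2\<close>.
\<close>
lemma sum_norm_perturbed_run_le:
  assumes \<sigma>: "1 / 2 \<le> \<sigma>" "\<sigma> < 1" "(1 - \<sigma>)\<^sup>2 \<le> 2 * \<sigma> * \<delta>"
    and y: "\<And>t i. i \<in> V \<Longrightarrow> y (Suc t) i = W (\<lambda>i. y t i + A (p t) i) i + h t i"
    and p: "p 0 = (\<lambda>i. 0)" "\<And>t. p (Suc t) = (\<lambda>i. \<sigma> * (W (p t) i - y t i))"
    and mean_zero: "\<And>t. sum (y t) V = 0"
    and h: "\<And>t. sqrt (inner_on V (h t) (h t)) \<le> B"
  shows "(\<Sum>t<T. sqrt (inner_on V (y t) (y t)))
    \<le> 4 / (1 - \<sigma>) * (sqrt (inner_on V (y 0) (y 0)) + real T * B)"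
proof -
  define s where "s t = sqrt (energy \<sigma> (y t) (p t))" for t
  have \<sigma>': "0 \<le> \<sigma>" "\<sigma> \<le> 1" using \<sigma> by auto
  have sum_p: "sum (p t) V = 0" for t
    by (induction t) (simp_all add: p sum_subtractf preserves_sum mean_zero sum_distrib_left[symmetric])
  have s_nonneg: "0 \<le> s t" for t
    unfolding s_def by (intro real_sqrt_ge_zero energy_nonneg[OF sum_p \<sigma>' \<sigma>(3)])
  have B: "0 \<le> B" using h[of 0] inner_on_nonneg[of V "h 0"] by (smt (verit) real_sqrt_ge_zero)
  have step: "s (Suc t) \<le> sqrt \<sigma> * s t + sqrt \<sigma> * B" for t
  proof -
    let ?w = "W (\<lambda>i. y t i + A (p t) i)"
    have "s (Suc t) = sqrt (energy \<sigma> (\<lambda>i. ?w i + h t i) (p (Suc t)))"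
      unfolding s_def using y by (simp cong: energy_cong)
    also have "\<dots> \<le> sqrt (energy \<sigma> ?w (p (Suc t))) + sqrt \<sigma> * sqrt (inner_on V (h t) (h t))"
      by (rule energy_perturb[OF sum_p \<sigma>' \<sigma>(3)])
    also have "\<dots> \<le> sqrt (\<sigma> * energy \<sigma> (y t) (p t)) + sqrt \<sigma> * B"
      unfolding p using \<sigma>' energy_step[OF mean_zero \<sigma>' \<sigma>(3)] h
      by (intro add_mono mult_left_mono real_sqrt_le_mono) auto
    finally show ?thesis by (simp add: s_def real_sqrt_mult)
  qed
  have telescope: "(1 - sqrt \<sigma>) * (\<Sum>t<T. s t) \<le> s 0 - s T + real T * (sqrt \<sigma> * B)"
  proof (induction T)
    case (Suc T)
    then show ?case using step[of T] by (simp add: algebra_simps)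
  qed simp
  have s0: "s 0 = sqrt \<sigma> * sqrt (inner_on V (y 0) (y 0))"
    by (simp add: s_def energy_def p W_zero inner_on_zero_left real_sqrt_mult
        inner_on_commute[of V _ "\<lambda>i. 0"] )
  have norm_le: "sqrt (inner_on V (y t) (y t)) \<le> sqrt 2 / sqrt \<sigma> * s t" for t
  proof -
    have "inner_on V (y t) (y t) \<le> 2 / \<sigma> * energy \<sigma> (y t) (p t)"
      using energy_ge[OF sum_p[of t] \<sigma>' \<sigma>(3), of "y t"] \<sigma> by (simp add: field_simps)
    then show ?thesis
      unfolding s_def by (metis real_sqrt_divide real_sqrt_le_mono real_sqrt_mult)
  qed
  have root: "(1 - \<sigma>) / 2 \<le> 1 - sqrt \<sigma>"
  proof -
    have "sqrt \<sigma> * 1 \<le> (\<sigma> + 1) / 2"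
      using arith_geo_mean_sqrt[of \<sigma> 1] \<sigma>' by simp
    then show ?thesis by (simp add: field_simps)
  qed
  let ?D = "sqrt (inner_on V (y 0) (y 0)) + real T * B"
  have D: "0 \<le> ?D" using B inner_on_nonneg[of V "y 0"] by simp
  have "(1 - \<sigma>) / 2 * (\<Sum>t<T. s t) \<le> (1 - sqrt \<sigma>) * (\<Sum>t<T. s t)"
    using root s_nonneg by (intro mult_right_mono sum_nonneg)
  also have "\<dots> \<le> sqrt \<sigma> * ?D"
    using telescope s_nonneg[of T] s0 by (simp add: algebra_simps)
  finally have S: "(\<Sum>t<T. s t) \<le> 2 / (1 - \<sigma>) * (sqrt \<sigma> * ?D)"
    using \<sigma> by (simp add: field_simps)
  have "(\<Sum>t<T. sqrt (inner_on V (y t) (y t))) \<le> sqrt 2 / sqrt \<sigma> * (\<Sum>t<T. s t)"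
    unfolding sum_distrib_left by (rule sum_mono) (rule norm_le)
  also have "\<dots> \<le> sqrt 2 / sqrt \<sigma> * (2 / (1 - \<sigma>) * (sqrt \<sigma> * ?D))"
    using S \<sigma>' by (intro mult_left_mono) auto
  also have "\<dots> = sqrt 2 * (2 / (1 - \<sigma>) * ?D)"
    using \<sigma> by (simp add: field_simps)
  also have "\<dots> \<le> 2 * (2 / (1 - \<sigma>) * ?D)"
    using D \<sigma> by (intro mult_right_mono mult_nonneg_nonneg) (auto intro: real_le_lsqrt)
  finally show ?thesis by simp
qed

end

section \<open>Spectral gap of the lazy Metropolis walk\<close>

text \<open>
A path of minimal length has no shortcut: reaching \<open>v j\<close> from \<open>v i\<close> takes at least \<open>j - i\<close> steps.  The case
of no step says that the vertices are distinct, the case of two steps controls common neighbours.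
\<close>
lemma shortest_path:
  assumes "(a, b) \<in> R\<^sup>*"
  obtains k :: nat and v where "v 0 = a" "v k = b" "\<And>i. i < k \<Longrightarrow> (v i, v (Suc i)) \<in> R"
    "\<And>i j m. i \<le> j \<Longrightarrow> j \<le> k \<Longrightarrow> (v i, v j) \<in> R ^^ m \<Longrightarrow> j \<le> i + m"
proof -
  define k where "k = (LEAST k. (a, b) \<in> R ^^ k)"
  have "\<exists>k. (a, b) \<in> R ^^ k" using assms by (rule rtrancl_imp_relpow)
  then have "(a, b) \<in> R ^^ k" unfolding k_def by (rule LeastI_ex)
  then obtain v where v: "v 0 = a" "v k = b" "\<And>i. i < k \<Longrightarrow> (v i, v (Suc i)) \<in> R"
    unfolding relpow_fun_conv by blast
  have segment: "(v i, v (i + m)) \<in> R ^^ m" if "i + m \<le> k" for i m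
    unfolding relpow_fun_conv using v(3) that by (intro exI[of _ "\<lambda>l. v (i + l)"]) auto
  have "j \<le> i + m" if "i \<le> j" "j \<le> k" "(v i, v j) \<in> R ^^ m" for i j m
  proof -
    have "(a, v i) \<in> R ^^ i" using segment[of 0 i] that v by simp
    moreover have "(v j, b) \<in> R ^^ (k - j)" using segment[of j "k - j"] that v by simp
    ultimately have "(a, b) \<in> R ^^ (i + m + (k - j))"
      using that(3) unfolding relpow_add by blast
    then have "k \<le> i + m + (k - j)" unfolding k_def by (rule Least_le)
    then show ?thesis using that by linarith
  qed
  then show thesis using that v by blast
qed

definition metropolis_weight :: "'a pair_pre_digraph \<Rightarrow> 'a \<Rightarrow> 'a \<Rightarrow> real" where
  "metropolis_weight G i j =
    (if (i, j) \<in> parcs G then 1 / real (max (degree G i) (degree G j)) else 0)"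

definition metropolis_step :: "'a pair_pre_digraph \<Rightarrow> ('a \<Rightarrow> real) \<Rightarrow> 'a \<Rightarrow> real" where
  "metropolis_step G u i =
    u i + 1/2 * (\<Sum>j\<in>neighbors G i. (u j - u i) / real (max (degree G i) (degree G j)))"

text \<open>
Twice the usual bilinear Dirichlet form of the weighted graph: every edge is counted in both
directions.
\<close>
definition dirichlet :: "'a pair_pre_digraph \<Rightarrow> ('a \<Rightarrow> real) \<Rightarrow> ('a \<Rightarrow> real) \<Rightarrow> real" where
  "dirichlet G a b =
    (\<Sum>i\<in>pverts G. \<Sum>j\<in>pverts G. metropolis_weight G i j * ((a i - a j) * (b i - b j)))"

context pair_graph
begin

lemma neighbors_subset: "neighbors G i \<subseteq> pverts G"
  by (auto simp: neighbors_def dest: arc_snd_in_verts)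

lemma parcs_sym: "(i, j) \<in> parcs G \<Longrightarrow> (j, i) \<in> parcs G"
  using pair_sym_arcs by (auto simp: symmetric_def sym_def)

lemma degree_pos: "(i, j) \<in> parcs G \<Longrightarrow> 0 < degree G i"
  using finite_subset[OF neighbors_subset pair_finite_verts]
  by (auto simp: degree_def neighbors_def card_gt_0_iff)

lemma metropolis_weight_commute: "metropolis_weight G i j = metropolis_weight G j i"
  by (auto simp: metropolis_weight_def max.commute dest: parcs_sym)

lemma metropolis_weight_nonneg: "0 \<le> metropolis_weight G i j"
  by (simp add: metropolis_weight_def)

lemma sum_metropolis_weight_le: "(\<Sum>j\<in>pverts G. metropolis_weight G i j) \<le> 1"
proof -
  have "(\<Sum>j\<in>pverts G. metropolis_weight G i j)
      = (\<Sum>j\<in>neighbors G i. 1 / real (max (degree G i) (degree G j)))"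
    using neighbors_subset pair_finite_verts
    by (intro sum.mono_neutral_cong_right) (auto simp: metropolis_weight_def neighbors_def)
  also have "\<dots> \<le> (\<Sum>j\<in>neighbors G i. 1 / real (degree G i))"
    by (intro sum_mono frac_le) (auto simp: neighbors_def dest: degree_pos)
  also have "\<dots> \<le> 1" by (simp add: degree_def)
  finally show ?thesis .
qed

lemma metropolis_step_eq:
  "metropolis_step G u i = u i + 1/2 * (\<Sum>j\<in>pverts G. metropolis_weight G i j * (u j - u i))"
proof -
  have "(\<Sum>j\<in>neighbors G i. (u j - u i) / real (max (degree G i) (degree G j)))
      = (\<Sum>j\<in>pverts G. metropolis_weight G i j * (u j - u i))"
    using neighbors_subset pair_finite_verts
    by (intro sum.mono_neutral_cong_left) (auto simp: metropolis_weight_def neighbors_def)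
  then show ?thesis by (simp add: metropolis_step_def)
qed

lemma sum_metropolis_swap:
  "(\<Sum>i\<in>pverts G. \<Sum>j\<in>pverts G. metropolis_weight G i j * F i j)
    = (\<Sum>i\<in>pverts G. \<Sum>j\<in>pverts G. metropolis_weight G i j * F j i)"
  by (subst sum.swap) (simp add: metropolis_weight_commute)

text \<open>
Summation by parts.  Self-adjointness, conservation of the sum (take \<open>a = 1\<close>), positivity and the gap
of the averaging step are all read off from this formula.
\<close>
lemma inner_metropolis_step:
  "inner_on (pverts G) a (metropolis_step G b) = inner_on (pverts G) a b - dirichlet G a b / 4"
proof -
  define S where "S = (\<Sum>i\<in>pverts G. \<Sum>j\<in>pverts G. metropolis_weight G i j * (a i * (b j - b i)))"
  \<comment> \<open>Exchanging the roles of \<open>i\<close> and \<open>j\<close> and averaging turns \<open>S\<close> into a form in the differences.\<close>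
  have "S = (\<Sum>i\<in>pverts G. \<Sum>j\<in>pverts G. metropolis_weight G i j * (a j * (b i - b j)))"
    unfolding S_def by (rule sum_metropolis_swap)
  then have "S + S = (\<Sum>i\<in>pverts G. \<Sum>j\<in>pverts G. metropolis_weight G i j * (a i * (b j - b i))
      + metropolis_weight G i j * (a j * (b i - b j)))"
    unfolding sum.distrib S_def[symmetric] by simp
  also have "\<dots> = - dirichlet G a b"
    unfolding dirichlet_def sum_negf[symmetric] by (intro sum.cong refl) (simp add: algebra_simps)
  finally have "S = - dirichlet G a b / 2" by simp
  moreover have "inner_on (pverts G) a (metropolis_step G b) = inner_on (pverts G) a b + S / 2"
    unfolding inner_on_def metropolis_step_eq S_def
    by (simp add: distrib_left sum.distrib sum_divide_distrib)
       (simp add: sum_distrib_left sum_divide_distrib algebra_simps)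
  ultimately show ?thesis by simp
qed

text \<open>
Laziness is what makes the averaging step positive: \<open>(u i - u j)\<^sup>2 \<le> 2 (u i)\<^sup>2 + 2 (u j)\<^sup>2\<close> and row sums of the
weights at most \<open>1\<close> keep the Dirichlet form below the threshold in \<open>inner_metropolis_step\<close>.
\<close>
lemma dirichlet_le: "dirichlet G u u \<le> 4 * inner_on (pverts G) u u"
proof -
  have "dirichlet G u u \<le> (\<Sum>i\<in>pverts G. \<Sum>j\<in>pverts G.
      metropolis_weight G i j * (2 * (u i)\<^sup>2) + metropolis_weight G i j * (2 * (u j)\<^sup>2))"
    unfolding dirichlet_def
  proof (intro sum_mono)
    fix i j
    have "0 \<le> (u i + u j)\<^sup>2" by simp
    then have "(u i - u j) * (u i - u j) \<le> 2 * (u i)\<^sup>2 + 2 * (u j)\<^sup>2"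
      by (simp add: power2_eq_square algebra_simps)
    from mult_left_mono[OF this metropolis_weight_nonneg]
    show "metropolis_weight G i j * ((u i - u j) * (u i - u j))
      \<le> metropolis_weight G i j * (2 * (u i)\<^sup>2) + metropolis_weight G i j * (2 * (u j)\<^sup>2)"
      by (simp add: distrib_left)
  qed
  also have "\<dots> = 4 * (\<Sum>i\<in>pverts G. (\<Sum>j\<in>pverts G. metropolis_weight G i j) * (u i)\<^sup>2)"
    unfolding sum.distrib sum_metropolis_swap[of "\<lambda>i j. 2 * (u j)\<^sup>2"]
    by (simp add: sum_distrib_left sum_distrib_right algebra_simps)
  also have "\<dots> \<le> 4 * (\<Sum>i\<in>pverts G. 1 * (u i)\<^sup>2)"
    by (intro mult_left_mono sum_mono mult_right_mono sum_metropolis_weight_le) auto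
  finally show ?thesis by (simp add: inner_on_def power2_eq_square)
qed

text \<open>
Count the incidences between path vertices and their neighbours from the side of the neighbour \<open>u\<close>:
two path vertices adjacent to \<open>u\<close> are joined by two steps through \<open>u\<close>, so their indices differ by
at most two.
\<close>
lemma sum_degrees_shortest_path_le:
  assumes "\<And>i j m. i \<le> j \<Longrightarrow> j \<le> k \<Longrightarrow> (v i, v j) \<in> parcs G ^^ m \<Longrightarrow> j \<le> i + m"
  shows "(\<Sum>i\<le>k. degree G (v i)) \<le> 3 * card (pverts G)"
proof -
  have "degree G (v i) = (\<Sum>u\<in>pverts G. if (v i, u) \<in> parcs G then 1 else 0)" for i
    using neighbors_subset pair_finite_verts
    by (simp add: degree_def neighbors_def sum.If_cases Int_absorb1 flip: Collect_conj_eq)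
  then have "(\<Sum>i\<le>k. degree G (v i)) = (\<Sum>u\<in>pverts G. \<Sum>i\<le>k. if (v i, u) \<in> parcs G then 1 else 0)"
    by (simp add: sum.swap[of _ "{..k}"])
  also have "\<dots> = (\<Sum>u\<in>pverts G. card {i. i \<le> k \<and> (v i, u) \<in> parcs G})"
    by (simp add: sum.If_cases Int_def)
  also have "\<dots> \<le> (\<Sum>u\<in>pverts G. 3)"
  proof (rule sum_mono)
    fix u
    let ?S = "{i. i \<le> k \<and> (v i, u) \<in> parcs G}"
    show "card ?S \<le> 3"
    proof (cases "?S = {}")
      case False
      have "Min ?S \<in> ?S" using False by (intro Min_in) auto
      then have min: "Min ?S \<le> k" "(v (Min ?S), u) \<in> parcs G" by auto
      have "?S \<subseteq> {Min ?S..Min ?S + 2}"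
      proof
        fix j assume j: "j \<in> ?S"
        then have "Min ?S \<le> j" by (intro Min_le) auto
        moreover have "(v (Min ?S), v j) \<in> parcs G ^^ 2"
          using min(2) j parcs_sym by (auto simp: numeral_2_eq_2)
        ultimately show "j \<in> {Min ?S..Min ?S + 2}"
          using assms[of "Min ?S" j 2] j by simp
      qed
      from card_mono[OF _ this] show ?thesis by simp
    qed (simp only: card.empty)
  qed
  finally show ?thesis by (simp add: mult.commute)
qed

text \<open>
In the language of electrical networks, the resistance of the edge \<open>i j\<close> is \<open>max (d i) (d j) \<le> d i + d j\<close>,
so a shortest path has resistance at most twice its sum of degrees, that is at most \<open>6 n\<close>.
Cauchy-Schwarz bounds the squared potential difference by resistance times energy.
\<close>
lemma square_diff_le_dirichlet:
  assumes "(a, b) \<in> (parcs G)\<^sup>*"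
  shows "(u a - u b)\<^sup>2 \<le> 6 * real (card (pverts G)) * dirichlet G u u"
proof -
  obtain k v where v: "v 0 = a" "v k = b" "\<And>i. i < k \<Longrightarrow> (v i, v (Suc i)) \<in> parcs G"
    and geodesic: "\<And>i j m. i \<le> j \<Longrightarrow> j \<le> k \<Longrightarrow> (v i, v j) \<in> parcs G ^^ m \<Longrightarrow> j \<le> i + m"
    using shortest_path[OF assms] by metis
  define e where "e i = (v i, v (Suc i))" for i
  define M where "M i = real (max (degree G (v i)) (degree G (v (Suc i))))" for i
  define d where "d i = u (v i) - u (v (Suc i))" for i
  have M_pos: "0 < M i" if "i < k" for i
    using degree_pos[OF v(3)[OF that]] by (simp add: M_def)
  have resistance: "(\<Sum>i<k. M i) \<le> 6 * real (card (pverts G))"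
  proof -
    have "(\<Sum>i<k. M i) \<le> (\<Sum>i<k. real (degree G (v i))) + (\<Sum>i<k. real (degree G (v (Suc i))))"
      unfolding sum.distrib[symmetric] M_def by (intro sum_mono) auto
    also have "\<dots> \<le> (\<Sum>i\<le>k. real (degree G (v i))) + (\<Sum>i\<le>k. real (degree G (v i)))"
    proof (rule add_mono)
      show "(\<Sum>i<k. real (degree G (v i))) \<le> (\<Sum>i\<le>k. real (degree G (v i)))"
        by (intro sum_mono2) auto
      show "(\<Sum>i<k. real (degree G (v (Suc i)))) \<le> (\<Sum>i\<le>k. real (degree G (v i)))"
        by (cases k) (simp_all add: sum.atMost_Suc_shift lessThan_Suc_atMost del: sum.atMost_Suc)
    qed
    also have "\<dots> = 2 * real (\<Sum>i\<le>k. degree G (v i))" by simp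
    also have "\<dots> \<le> 2 * real (3 * card (pverts G))"
      using sum_degrees_shortest_path_le[of k v, OF geodesic] by (intro mult_left_mono of_nat_mono) auto
    finally show ?thesis by simp
  qed
  have energy: "(\<Sum>i<k. (d i)\<^sup>2 / M i) \<le> dirichlet G u u"
  proof -
    let ?F = "\<lambda>(x, y). metropolis_weight G x y * ((u x - u y) * (u x - u y))"
    \<comment> \<open>The path uses each arc once, so its energy is part of the total energy.\<close>
    have "inj_on e {..<k}"
    proof (rule linorder_inj_onI)
      fix i j assume "i < j" "i \<in> {..<k}" "j \<in> {..<k}"
      moreover have "\<not> j \<le> i + 0" using \<open>i < j\<close> by simp
      ultimately have "(v i, v j) \<notin> parcs G ^^ 0"
        using geodesic[of i j 0] by (meson less_imp_le lessThan_iff)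
      then show "e i \<noteq> e j" by (simp add: e_def)
    qed auto
    then have "(\<Sum>i<k. (d i)\<^sup>2 / M i) = sum ?F (e ` {..<k})"
      by (subst sum.reindex)
         (auto simp: e_def d_def M_def metropolis_weight_def v(3) power2_eq_square intro!: sum.cong)
    also have "\<dots> \<le> sum ?F (pverts G \<times> pverts G)"
      using pair_finite_verts arc_fst_in_verts[OF v(3)] arc_snd_in_verts[OF v(3)]
      by (intro sum_mono2) (auto simp: e_def metropolis_weight_nonneg)
    finally show ?thesis by (simp add: dirichlet_def sum.cartesian_product)
  qed
  have "u a - u b = (\<Sum>i<k. d i)"
    using sum_lessThan_telescope'[of "\<lambda>i. u (v i)" k] by (simp add: d_def v)
  also have "\<dots> = (\<Sum>i<k. sqrt (M i) * (d i / sqrt (M i)))"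
    by (intro sum.cong) (auto dest: M_pos)
  finally have "(u a - u b)\<^sup>2 \<le> (\<Sum>i<k. (sqrt (M i))\<^sup>2) * (\<Sum>i<k. (d i / sqrt (M i))\<^sup>2)"
    by (simp only: Cauchy_Schwarz_ineq_sum)
  also have "\<dots> = (\<Sum>i<k. M i) * (\<Sum>i<k. (d i)\<^sup>2 / M i)"
    by (intro arg_cong2[of _ _ _ _ "(*)"] sum.cong) (auto simp: power_divide dest: M_pos)
  also have "\<dots> \<le> 6 * real (card (pverts G)) * dirichlet G u u"
    using resistance energy by (intro mult_mono sum_nonneg) (auto dest: M_pos)
  finally show ?thesis .
qed

lemma connected_reachable:
  assumes "Digraph_Component.connected (with_proj G)" "a \<in> pverts G" "b \<in> pverts G"
  shows "(a, b) \<in> (parcs G)\<^sup>*"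
proof -
  have "strongly_connected (with_proj G)"
    using symmetric_connected_imp_strongly_connected[OF pair_sym_arcs] assms(1) by simp
  then have "(a, b) \<in> rtrancl_on (pverts G) (parcs G)"
    using assms(2,3) by (simp add: strongly_connected_def reachable_def)
  then show ?thesis by (induct rule: rtrancl_on_induct) auto
qed

lemma poincare:
  assumes "Digraph_Component.connected (with_proj G)" "sum u (pverts G) = 0"
  shows "inner_on (pverts G) u u \<le> 3 * (real (card (pverts G)))\<^sup>2 * dirichlet G u u"
proof -
  let ?V = "pverts G" and ?n = "real (card (pverts G))"
  have "?n > 0"
    using assms(1) pair_finite_verts
    by (auto simp: Digraph_Component.connected_def strongly_connected_def card_gt_0_iff)
  \<comment> \<open>For a vector of sum zero, the variance is half the mean squared difference of two entries.\<close>
  have "2 * ?n * inner_on ?V u u = (\<Sum>a\<in>?V. \<Sum>b\<in>?V. (u a - u b)\<^sup>2)"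
    unfolding power2_diff
    by (simp add: sum.distrib sum_subtractf inner_on_def power2_eq_square mult.assoc assms(2)
        flip: sum_distrib_left sum_distrib_right)
  also have "\<dots> \<le> (\<Sum>a\<in>?V. \<Sum>b\<in>?V. 6 * ?n * dirichlet G u u)"
    by (intro sum_mono square_diff_le_dirichlet connected_reachable assms)
  also have "\<dots> = 2 * ?n * (3 * ?n\<^sup>2 * dirichlet G u u)"
    by (simp add: power2_eq_square)
  finally show ?thesis by (rule mult_left_le_imp_le) (use \<open>?n > 0\<close> in simp)
qed

lemma consensus_operator_metropolis:
  assumes "Digraph_Component.connected (with_proj G)"
  shows "consensus_operator (pverts G) (metropolis_step G) (1 / (12 * (real (card (pverts G)))\<^sup>2))"
proof
  show "metropolis_step G (\<lambda>i. a i + c * b i) = (\<lambda>i. metropolis_step G a i + c * metropolis_step G b i)" for a b c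
    by (simp add: metropolis_step_eq fun_eq_iff sum.distrib sum_distrib_left sum_subtractf algebra_simps)
  show "metropolis_step G a i = metropolis_step G b i"
    if "\<And>i. i \<in> pverts G \<Longrightarrow> a i = b i" "i \<in> pverts G" for a b i
    using that by (simp add: metropolis_step_eq)
  have dir_comm: "dirichlet G a b = dirichlet G b a" for a b
    by (simp add: dirichlet_def mult.commute)
  show "inner_on (pverts G) (metropolis_step G a) b = inner_on (pverts G) a (metropolis_step G b)" for a b
    by (simp add: inner_on_commute[of _ _ b] inner_metropolis_step dir_comm)
  show "0 \<le> inner_on (pverts G) a (metropolis_step G a)" for a
    using dirichlet_le[of a] by (simp add: inner_metropolis_step)
  show "sum (metropolis_step G a) (pverts G) = sum a (pverts G)" for a
    using inner_metropolis_step[of "\<lambda>_. 1" a] by (simp add: inner_on_def dirichlet_def)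
  have n: "0 < real (card (pverts G))"
    using assms pair_finite_verts
    by (auto simp: Digraph_Component.connected_def strongly_connected_def card_gt_0_iff)
  have "0 < 1 / (12 * N\<^sup>2)" if "0 < N" for N :: real using that by simp
  from this[OF n] show "0 < 1 / (12 * (real (card (pverts G)))\<^sup>2)" .
  show "1 / (12 * (real (card (pverts G)))\<^sup>2) * inner_on (pverts G) a a
      \<le> inner_on (pverts G) a a - inner_on (pverts G) a (metropolis_step G a)"
    if "sum a (pverts G) = 0" for a
  proof -
    have "1 / (12 * N\<^sup>2) * q \<le> d / 4" if "q \<le> 3 * N\<^sup>2 * d" "0 < N" for q N d :: real
      using that by (simp add: field_simps)
    from this[OF poincare[OF assms that] n] show ?thesis
      by (simp add: inner_metropolis_step)
  qed
qed

end

section \<open>Disagreement and progress of the accelerated subgradient run\<close>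

locale accelerated_run = pair_graph G for G :: "nat pair_pre_digraph" +
  fixes n :: nat and f :: "nat \<Rightarrow> real \<Rightarrow> real" and U \<beta> L :: real
    and x y z g :: "nat \<Rightarrow> nat \<Rightarrow> real"
  assumes vertices: "pverts G = {1..n}"
    and connected: "Digraph_Component.connected (with_proj G)"
    and U_ge: "real n \<le> U"
    and run: "accelerated_subgradient_run G f U \<beta> x y z g"
    and step_nonneg: "0 \<le> \<beta>"
    and subgradient_bounded: "1 \<le> t \<Longrightarrow> i \<in> {1..n} \<Longrightarrow> \<bar>g t i\<bar> \<le> L"
begin

sublocale consensus_operator "{1..n}" "metropolis_step G" "1 / (12 * (real n)\<^sup>2)"
  using consensus_operator_metropolis[OF connected] by (simp add: vertices)

abbreviation "W \<equiv> metropolis_step G"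

definition \<sigma> :: real where "\<sigma> = 1 - 2 / (9 * U + 1)"

lemma n_pos: "0 < n"
  using connected vertices by (cases n) (auto simp: Digraph_Component.connected_def strongly_connected_def)

lemma L_nonneg: "0 \<le> L"
  using subgradient_bounded[of 1 1] n_pos by auto

text \<open>
With \<open>1 - \<sigma> = 2 / (9 U + 1)\<close> and \<open>\<sigma> = (9 U - 1) / (9 U + 1)\<close>, the condition linking \<open>\<sigma>\<close> to the gap amounts
to \<open>24 n\<^sup>2 \<le> 81 U\<^sup>2 - 1\<close>.
\<close>
lemma momentum_bounds: "1 / 2 \<le> \<sigma>" "\<sigma> < 1" "(1 - \<sigma>)\<^sup>2 \<le> 2 * \<sigma> * (1 / (12 * (real n)\<^sup>2))"
proof -
  have U: "1 \<le> U" and n: "1 \<le> real n" using U_ge n_pos by linarith+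
  show "1 / 2 \<le> \<sigma>" "\<sigma> < 1" using U by (simp_all add: \<sigma>_def field_simps)
  have "(real n)\<^sup>2 \<le> U\<^sup>2" using U_ge by (intro power_mono) auto
  moreover have "1 \<le> U\<^sup>2" using U by simp
  ultimately have "24 * (real n)\<^sup>2 \<le> (9 * U - 1) * (9 * U + 1)"
    by (simp add: algebra_simps power2_eq_square)
  then have bound: "24 * (real n)\<^sup>2 * (9 * U + 1) \<le> (9 * U - 1) * (9 * U + 1) * (9 * U + 1)"
    using U by (intro mult_right_mono) auto
  have \<sigma>_eq: "\<sigma> = (9 * U - 1) / (9 * U + 1)" and one_minus_\<sigma>_eq: "1 - \<sigma> = 2 / (9 * U + 1)"
    using U by (simp_all add: \<sigma>_def field_simps)
  have "(2 / K)\<^sup>2 \<le> 2 * (J / K) * (1 / (12 * N))"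
    if "24 * N * K \<le> J * K * K" "0 < K" "0 < N" for J K N :: real
    using that by (simp add: field_simps power2_eq_square)
  from this[OF bound] show "(1 - \<sigma>)\<^sup>2 \<le> 2 * \<sigma> * (1 / (12 * (real n)\<^sup>2))"
    unfolding one_minus_\<sigma>_eq \<sigma>_eq[symmetric] using U n_pos by simp
qed

lemma y_1: "i \<in> {1..n} \<Longrightarrow> y 1 i = x 1 i"
  using run by (simp add: accelerated_subgradient_run_def vertices)

lemma y_Suc: "1 \<le> t \<Longrightarrow> i \<in> {1..n} \<Longrightarrow> y (Suc t) i = W (x t) i - \<beta> * g t i"
  using run by (simp add: accelerated_subgradient_run_def vertices metropolis_step_def)

lemma x_Suc: "1 \<le> t \<Longrightarrow> i \<in> {1..n} \<Longrightarrow> x (Suc t) i = y (Suc t) i + \<sigma> * (y (Suc t) i - y t i + \<beta> * g t i)"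
proof -
  assume "1 \<le> t" "i \<in> {1..n}"
  then have "x (Suc t) i = y (Suc t) i + \<sigma> * (y (Suc t) i - z (Suc t) i)" "z (Suc t) i = y t i - \<beta> * g t i"
    using run by (simp_all add: accelerated_subgradient_run_def vertices \<sigma>_def)
  then show ?thesis by (simp add: algebra_simps)
qed

lemma subgradient: "1 \<le> t \<Longrightarrow> i \<in> {1..n} \<Longrightarrow> is_subgradient (f i) (y t i) (g t i)"
  using run by (simp add: accelerated_subgradient_run_def vertices)

lemma sum_y_Suc: "1 \<le> t \<Longrightarrow> sum (y (Suc t)) {1..n} = sum (x t) {1..n} - \<beta> * sum (g t) {1..n}"
  using preserves_sum[of "x t"] by (simp add: y_Suc sum_subtractf sum_distrib_left)

text \<open>
The momentum has mean zero at every time: it starts at zero, and the extrapolation adds \<open>\<sigma>\<close> times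
\<open>W (x t) - y t\<close>, which has mean zero as long as \<open>x t\<close> and \<open>y t\<close> have the same mean.
\<close>
lemma sum_x: "1 \<le> t \<Longrightarrow> sum (x t) {1..n} = sum (y t) {1..n}"
proof (induction t rule: nat_induct_at_least)
  case base
  show ?case by (intro sum.cong refl) (simp only: y_1)
next
  case (Suc t)
  then show ?case
    by (simp add: x_Suc sum.distrib sum_subtractf sum_y_Suc del: One_nat_def flip: sum_distrib_left)
qed

text \<open>
Time starts at \<open>1\<close> in the run; in the quantities below it is shifted to start at \<open>0\<close>.
\<close>
definition mean :: "nat \<Rightarrow> real" where
  "mean t = average n (y (Suc t))"

definition deviation :: "nat \<Rightarrow> nat \<Rightarrow> real" where
  "deviation t i = y (Suc t) i - mean t"

lemma mean_Suc: "mean (Suc t) = mean t - \<beta> * average n (g (Suc t))"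
  by (simp add: mean_def average_def sum_y_Suc sum_x diff_divide_distrib del: One_nat_def)

lemma sum_deviation: "sum (deviation t) {1..n} = 0"
  using n_pos by (simp add: deviation_def mean_def average_def sum_subtractf)

lemma norm_centred_le:
  assumes "\<And>i. i \<in> {1..n} \<Longrightarrow> \<bar>v i\<bar> \<le> L"
  shows "sqrt (inner_on {1..n} (\<lambda>i. v i - average n v) (\<lambda>i. v i - average n v)) \<le> L * sqrt (real n)"
proof -
  have "inner_on {1..n} (\<lambda>i. v i - average n v) (\<lambda>i. v i - average n v)
      = (\<Sum>i=1..n. (v i)\<^sup>2) - real n * (average n v)\<^sup>2"
  proof -
    have "sum v {1..n} = real n * average n v" using n_pos by (simp add: average_def)
    then show ?thesis
      by (simp add: inner_on_def algebra_simps sum.distrib sum_subtractf power2_eq_square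
          flip: sum_distrib_left sum_distrib_right)
  qed
  also have "\<dots> \<le> (\<Sum>i=1..n. (v i)\<^sup>2)" by simp
  also have "\<dots> \<le> (\<Sum>i=1..n. L\<^sup>2)"
    by (intro sum_mono) (metis assms abs_ge_zero power2_abs power_mono)
  finally have "sqrt (inner_on {1..n} (\<lambda>i. v i - average n v) (\<lambda>i. v i - average n v))
      \<le> sqrt (L\<^sup>2 * real n)"
    by (intro real_sqrt_le_mono) (simp add: mult.commute)
  then show ?thesis using L_nonneg by (simp add: real_sqrt_mult)
qed

text \<open>
The auxiliary sequence \<open>p\<close> with \<open>x - y = A p\<close> exists because the momentum obeys
\<open>m' = \<sigma> (W m - A y)\<close> and starts at zero, so it never leaves the range of \<open>A\<close>.  This avoids
inverting \<open>A\<close> on the vectors of sum zero.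
\<close>
lemma sum_norm_deviation_le:
  "(\<Sum>t<T. L2_set (deviation t) {1..n})
    \<le> 2 * (9 * U + 1) * (L2_set (deviation 0) {1..n} + real T * (\<beta> * (L * sqrt (real n))))"
proof -
  define p where "p = rec_nat (\<lambda>i. 0) (\<lambda>t q i. \<sigma> * (W q i - deviation t i))"
  have p: "p 0 = (\<lambda>i. 0)" "p (Suc t) = (\<lambda>i. \<sigma> * (W (p t) i - deviation t i))" for t
    by (simp_all add: p_def)
  have W_const: "W (\<lambda>i. k) = (\<lambda>i. k)" for k
    by (simp add: metropolis_step_def fun_eq_iff)
  have W_x: "W (x (Suc t)) i = W (\<lambda>i. deviation t i + A (p t) i) i + mean t"
    if "\<And>i. i \<in> {1..n} \<Longrightarrow> x (Suc t) i = y (Suc t) i + A (p t) i" "i \<in> {1..n}" for t i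
  proof -
    have "W (x (Suc t)) i = W (\<lambda>i. (deviation t i + A (p t) i) + mean t) i"
      by (rule locality) (use that in \<open>auto simp: deviation_def\<close>)
    then show ?thesis by (simp add: W_linear W_const)
  qed
  have momentum: "x (Suc t) i = y (Suc t) i + A (p t) i" if "i \<in> {1..n}" for t i
    using that
  proof (induction t arbitrary: i)
    case 0
    then show ?case using y_1[of i] by (simp add: p A_def W_zero)
  next
    case (Suc t)
    have "x (Suc (Suc t)) i - y (Suc (Suc t)) i = \<sigma> * (W (x (Suc t)) i - y (Suc t) i)"
      using Suc.prems by (simp add: x_Suc y_Suc[of "Suc t"])
    also have "\<dots> = \<sigma> * (W (\<lambda>i. deviation t i + A (p t) i) i - deviation t i)"
      using W_x[OF Suc.IH Suc.prems] by (simp add: deviation_def)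
    also have "\<dots> = A (p (Suc t)) i"
      by (simp add: p A_def W_linear algebra_simps)
    finally show ?case by simp
  qed
  define h where "h t i = - \<beta> * (g (Suc t) i - average n (g (Suc t)))" for t i
  have "deviation (Suc t) i = W (\<lambda>i. deviation t i + A (p t) i) i + h t i" if "i \<in> {1..n}" for t i
    using W_x[OF momentum that] that
    by (simp add: deviation_def[of "Suc t"] y_Suc mean_Suc h_def algebra_simps)
  moreover have "sqrt (inner_on {1..n} (h t) (h t)) \<le> \<beta> * (L * sqrt (real n))" for t
  proof -
    let ?c = "\<lambda>i. g (Suc t) i - average n (g (Suc t))"
    have "inner_on {1..n} (h t) (h t) = \<beta>\<^sup>2 * inner_on {1..n} ?c ?c"
      unfolding inner_on_def h_def sum_distrib_left
      by (intro sum.cong) (auto simp: power2_eq_square)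
    then show ?thesis
      using norm_centred_le[of "g (Suc t)"] subgradient_bounded[of "Suc t"] step_nonneg
      by (simp add: real_sqrt_mult mult_left_mono)
  qed
  ultimately have "(\<Sum>t<T. sqrt (inner_on {1..n} (deviation t) (deviation t)))
      \<le> 4 / (1 - \<sigma>) * (sqrt (inner_on {1..n} (deviation 0) (deviation 0))
        + real T * (\<beta> * (L * sqrt (real n))))"
    by (intro sum_norm_perturbed_run_le[OF momentum_bounds _ p sum_deviation])
  moreover have "4 / (1 - \<sigma>) = 2 * (9 * U + 1)"
    by (simp add: \<sigma>_def)
  ultimately show ?thesis
    by (simp add: L2_set_def inner_on_def power2_eq_square)
qed

definition mean_deviation :: "nat \<Rightarrow> real" where
  "mean_deviation t = (\<Sum>i=1..n. \<bar>deviation t i\<bar>) / real n"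

lemma mean_deviation_le: "mean_deviation t \<le> L2_set (deviation t) {1..n} / sqrt (real n)"
proof -
  have "(\<Sum>i=1..n. \<bar>deviation t i\<bar> * \<bar>1\<bar>) \<le> L2_set (deviation t) {1..n} * L2_set (\<lambda>i. 1) {1..n}"
    by (rule L2_set_mult_ineq)
  also have "L2_set (\<lambda>i. 1) {1..n} = sqrt (real n)" by (simp add: L2_set_def)
  finally have "mean_deviation t \<le> L2_set (deviation t) {1..n} * sqrt (real n) / real n"
    unfolding mean_deviation_def by (simp add: divide_right_mono)
  also have "\<dots> = L2_set (deviation t) {1..n} * (sqrt (real n) / real n)" by simp
  also have "\<dots> = L2_set (deviation t) {1..n} / sqrt (real n)"
    by (simp only: sqrt_divide_self_eq[OF of_nat_0_le_iff]
        divide_inverse[of "L2_set (deviation t) {1..n}"])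
  finally show ?thesis .
qed

text \<open>
The standard estimate for one subgradient step from \<open>mean t\<close>, except that the subgradients are taken at
\<open>y (Suc t) i\<close>.  As \<open>mean t - w = (y (Suc t) i - w) - deviation t i\<close>, the mismatch costs \<open>L\<close> times the
deviation.
\<close>
lemma distance_Suc_le:
  "(mean (Suc t) - w)\<^sup>2 \<le> (mean t - w)\<^sup>2
    - 2 * \<beta> * ((\<Sum>i=1..n. f i (y (Suc t) i)) / real n - average_function n f w)
    + (\<beta> * L)\<^sup>2 + 2 * \<beta> * L * mean_deviation t"
proof -
  define s where "s = average n (g (Suc t))"
  have bound: "\<bar>g (Suc t) i\<bar> \<le> L" if "i \<in> {1..n}" for i
    using subgradient_bounded[of "Suc t" i] that by simp
  have "\<bar>s\<bar> \<le> (\<Sum>i=1..n. L) / real n"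
    unfolding s_def average_def abs_divide
    by (intro frac_le order_trans[OF sum_abs] sum_mono bound) (use n_pos L_nonneg in auto)
  then have "s\<^sup>2 \<le> L\<^sup>2" using n_pos L_nonneg by (simp add: abs_le_square_iff[symmetric])
  then have square: "(\<beta> * s)\<^sup>2 \<le> (\<beta> * L)\<^sup>2"
    by (simp add: power_mult_distrib mult_left_mono)
  have "f i (y (Suc t) i) - f i w - L * \<bar>deviation t i\<bar> \<le> g (Suc t) i * (mean t - w)"
    if "i \<in> {1..n}" for i
  proof -
    have "f i w \<ge> f i (y (Suc t) i) + g (Suc t) i * (w - y (Suc t) i)"
      using subgradient[of "Suc t" i] that by (simp add: is_subgradient_def)
    moreover have "g (Suc t) i * deviation t i \<le> L * \<bar>deviation t i\<bar>"
      by (rule order_trans[OF abs_ge_self[of "g (Suc t) i * deviation t i", unfolded abs_mult] mult_right_mono[OF bound[OF that] abs_ge_zero]])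
    ultimately show ?thesis by (simp add: deviation_def algebra_simps)
  qed
  then have "(\<Sum>i=1..n. f i (y (Suc t) i) - f i w - L * \<bar>deviation t i\<bar>) / real n
      \<le> (\<Sum>i=1..n. g (Suc t) i * (mean t - w)) / real n"
    by (intro divide_right_mono sum_mono) auto
  then have "(\<Sum>i=1..n. f i (y (Suc t) i)) / real n - average_function n f w - L * mean_deviation t
      \<le> s * (mean t - w)"
    by (simp add: s_def average_def average_function_def mean_deviation_def sum_subtractf
        diff_divide_distrib flip: sum_distrib_left sum_distrib_right)
  then have "2 * \<beta> * ((\<Sum>i=1..n. f i (y (Suc t) i)) / real n - average_function n f w - L * mean_deviation t)
      \<le> 2 * \<beta> * (s * (mean t - w))"
    using step_nonneg by (intro mult_left_mono) auto
  moreover have "(mean (Suc t) - w)\<^sup>2 = (mean t - w)\<^sup>2 - 2 * \<beta> * (s * (mean t - w)) + (\<beta> * s)\<^sup>2"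
    by (simp add: mean_Suc s_def power2_eq_square algebra_simps)
  ultimately show ?thesis using square by (simp add: algebra_simps)
qed

lemma sum_excess_le:
  "2 * \<beta> * (\<Sum>t<T. (\<Sum>i=1..n. f i (y (Suc t) i)) / real n - average_function n f w)
    \<le> (mean 0 - w)\<^sup>2 + real T * (\<beta> * L)\<^sup>2 + 2 * \<beta> * L * (\<Sum>t<T. mean_deviation t)"
proof -
  have "2 * \<beta> * (\<Sum>t<T. (\<Sum>i=1..n. f i (y (Suc t) i)) / real n - average_function n f w)
    \<le> (mean 0 - w)\<^sup>2 - (mean T - w)\<^sup>2 + real T * (\<beta> * L)\<^sup>2 + 2 * \<beta> * L * (\<Sum>t<T. mean_deviation t)"
  proof (induction T)
    case (Suc T)
    then show ?case using distance_Suc_le[of T w] by (simp add: algebra_simps)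
  qed simp
  then show ?thesis using zero_le_power2[of "mean T - w"] by linarith
qed

definition time_mean_deviation :: "nat \<Rightarrow> real" where
  "time_mean_deviation T = (\<Sum>t<T. mean_deviation t) / real T"

lemma time_average_deviation_le:
  assumes "1 \<le> T"
  shows "(\<Sum>i=1..n. \<bar>time_average T y i - (\<Sum>t<T. mean t) / real T\<bar>) / real n \<le> time_mean_deviation T"
proof -
  have "\<bar>time_average T y i - (\<Sum>t<T. mean t) / real T\<bar> \<le> (\<Sum>t<T. \<bar>deviation t i\<bar>) / real T" for i
  proof -
    have "time_average T y i - (\<Sum>t<T. mean t) / real T = (\<Sum>t<T. deviation t i) / real T"
      by (simp add: time_average_def sum.atLeast1_atMost_eq deviation_def sum_subtractf diff_divide_distrib)
    then show ?thesis by (simp add: divide_right_mono)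
  qed
  then have "(\<Sum>i=1..n. \<bar>time_average T y i - (\<Sum>t<T. mean t) / real T\<bar>) / real n
      \<le> (\<Sum>i=1..n. (\<Sum>t<T. \<bar>deviation t i\<bar>) / real T) / real n"
    by (intro divide_right_mono sum_mono) auto
  also have "\<dots> = (\<Sum>t<T. \<Sum>i=1..n. \<bar>deviation t i\<bar>) / (real T * real n)"
    by (subst sum.swap) (simp flip: sum_divide_distrib)
  also have "\<dots> = time_mean_deviation T"
    by (simp add: time_mean_deviation_def mean_deviation_def mult.commute flip: sum_divide_distrib)
  finally show ?thesis .
qed

lemma time_mean_deviation_le:
  "time_mean_deviation T \<le> 2 * (9 * U + 1) * (L2_set (deviation 0) {1..n}
     + real T * (\<beta> * (L * sqrt (real n)))) / (sqrt (real n) * real T)"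
proof -
  have "(\<Sum>t<T. mean_deviation t) \<le> (\<Sum>t<T. L2_set (deviation t) {1..n}) / sqrt (real n)"
    unfolding sum_divide_distrib by (intro sum_mono mean_deviation_le)
  also have "\<dots> \<le> 2 * (9 * U + 1) * (L2_set (deviation 0) {1..n}
     + real T * (\<beta> * (L * sqrt (real n)))) / sqrt (real n)"
    by (intro divide_right_mono sum_norm_deviation_le) simp
  finally have "(\<Sum>t<T. mean_deviation t) / real T \<le> 2 * (9 * U + 1) * (L2_set (deviation 0) {1..n}
     + real T * (\<beta> * (L * sqrt (real n)))) / sqrt (real n) / real T"
    by (rule divide_right_mono) simp
  then show ?thesis by (simp add: time_mean_deviation_def)
qed

lemma err_le:
  assumes "\<And>i. i \<in> {1..n} \<Longrightarrow> convex_on UNIV (f i)" "1 \<le> T" "0 < \<beta>"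
  shows "err n f w (time_average T y)
    \<le> (mean 0 - w)\<^sup>2 / (2 * \<beta> * real T) + \<beta> * L\<^sup>2 / 2 + L * time_mean_deviation T"
proof -
  have "(\<Sum>i=1..n. f i (time_average T y i)) \<le> (\<Sum>i=1..n. (\<Sum>k=1..T. f i (y k i)) / real T)"
    unfolding time_average_def using assms(1,2) by (intro sum_mono jensen_uniform)
  then have "err n f w (time_average T y)
      \<le> (\<Sum>i=1..n. (\<Sum>k=1..T. f i (y k i)) / real T) / real n - average_function n f w"
    unfolding err_def by (intro diff_right_mono divide_right_mono) auto
  also have "(\<Sum>i=1..n. (\<Sum>k=1..T. f i (y k i)) / real T) / real n
      = (\<Sum>t<T. (\<Sum>i=1..n. f i (y (Suc t) i)) / real n) / real T"
    by (simp add: sum.atLeast1_atMost_eq sum.swap[of _ "{..<T}"] mult.commute flip: sum_divide_distrib)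
  also have "\<dots> - average_function n f w
      = 2 * \<beta> * (\<Sum>t<T. (\<Sum>i=1..n. f i (y (Suc t) i)) / real n - average_function n f w)
        / (2 * \<beta> * real T)"
    using assms(2,3) by (simp add: sum_subtractf diff_divide_distrib)
  also have "\<dots> \<le> ((mean 0 - w)\<^sup>2 + real T * (\<beta> * L)\<^sup>2 + 2 * \<beta> * L * (\<Sum>t<T. mean_deviation t))
        / (2 * \<beta> * real T)"
    using assms(3) by (intro divide_right_mono sum_excess_le) auto
  also have "\<dots> = (mean 0 - w)\<^sup>2 / (2 * \<beta> * real T) + \<beta> * L\<^sup>2 / 2 + L * time_mean_deviation T"
    using assms(2,3) by (simp add: time_mean_deviation_def field_simps power2_eq_square)
  finally show ?thesis .
qed

end

section \<open>Convergence rate\<close>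

theorem theorem3p1:
  fixes c :: real
  shows
    "\<exists>C>0. \<forall>(n::nat) (G :: nat pair_pre_digraph) (f :: nat \<Rightarrow> real \<Rightarrow> real)
        (U::real) (L::real) (T::nat) (w::real)
        (x :: nat \<Rightarrow> nat \<Rightarrow> real) (y :: nat \<Rightarrow> nat \<Rightarrow> real)
        (z :: nat \<Rightarrow> nat \<Rightarrow> real) (g :: nat \<Rightarrow> nat \<Rightarrow> real).
      pair_graph G \<and> pverts G = {1..n} \<and> Digraph_Component.connected (with_proj G) \<and>
      (\<forall>i\<in>{1..n}. convex_on UNIV (f i)) \<and>
      real n \<le> U \<and> U \<le> c * real n \<and>
      (\<forall>\<theta>. average_function n f w \<le> average_function n f \<theta>) \<and>
      L > 0 \<and> (\<forall>i\<in>{1..n}. \<forall>\<theta> s. is_subgradient (f i) \<theta> s \<longrightarrow> \<bar>s\<bar> \<le> L) \<and>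
      T \<ge> 1 \<and>
      accelerated_subgradient_run G f U (1 / (L * sqrt (U * real T))) x y z g
      \<longrightarrow>
      (let xbar = average n (x 1);
           D = L2_set (\<lambda>i. y 1 i - xbar) {1..n};
           yhat = time_average T y
       in \<bar>disp n yhat\<bar> \<le> C * (sqrt (real n / real T) * (D / sqrt (real T) + 1)) \<and>
          \<bar>err n f w yhat\<bar>
            \<le> C * (L * sqrt (real n / real T) * (D / sqrt (real T) + 1 + (xbar - w)\<^sup>2)))"
  \<comment> \<open>The disagreement contributes \<open>20 c\<close> and the subgradient method another \<open>c\<close> and \<open>1\<close>.  The absolute value and the
    summand \<open>1\<close> keep the constant positive for every real \<open>c\<close>.\<close>
proof (intro exI[of _ "21 * \<bar>c\<bar> + 1"] conjI allI impI)
  show "0 < 21 * \<bar>c\<bar> + 1" by linarith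
next
  fix n :: nat and G :: "nat pair_pre_digraph" and f :: "nat \<Rightarrow> real \<Rightarrow> real"
    and U L :: real and T :: nat and w :: real and x y z g :: "nat \<Rightarrow> nat \<Rightarrow> real"
  assume hyps: "pair_graph G \<and> pverts G = {1..n} \<and> Digraph_Component.connected (with_proj G) \<and>
      (\<forall>i\<in>{1..n}. convex_on UNIV (f i)) \<and>
      real n \<le> U \<and> U \<le> c * real n \<and>
      (\<forall>\<theta>. average_function n f w \<le> average_function n f \<theta>) \<and>
      L > 0 \<and> (\<forall>i\<in>{1..n}. \<forall>\<theta> s. is_subgradient (f i) \<theta> s \<longrightarrow> \<bar>s\<bar> \<le> L) \<and>
      T \<ge> 1 \<and>
      accelerated_subgradient_run G f U (1 / (L * sqrt (U * real T))) x y z g"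
  define \<beta> where "\<beta> = 1 / (L * sqrt (U * real T))"
  have L: "0 < L" and T: "1 \<le> T" and U: "real n \<le> U" "U \<le> c * real n"
    and convex: "\<And>i. i \<in> {1..n} \<Longrightarrow> convex_on UNIV (f i)"
    and bounded: "\<And>i \<theta> s. i \<in> {1..n} \<Longrightarrow> is_subgradient (f i) \<theta> s \<Longrightarrow> \<bar>s\<bar> \<le> L"
    and minimizer: "\<And>\<theta>. average_function n f w \<le> average_function n f \<theta>"
    and run: "accelerated_subgradient_run G f U \<beta> x y z g"
    using hyps unfolding \<beta>_def by blast+
  have pg: "pair_graph G" "pverts G = {1..n}" "Digraph_Component.connected (with_proj G)"
    using hyps by blast+
  have "\<bar>g t i\<bar> \<le> L" if "1 \<le> t" "i \<in> {1..n}" for t i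
    using run that pg(2) by (intro bounded[of i "y t i"]) (auto simp: accelerated_subgradient_run_def)
  moreover have "0 \<le> \<beta>" using L U(1) by (simp add: \<beta>_def)
  ultimately interpret accelerated_run G n f U \<beta> L x y z g
    using pg U(1) run by (intro accelerated_run.intro accelerated_run_axioms.intro)
  have n: "1 \<le> real n" using n_pos by linarith
  have "real n \<le> c * real n" using U by linarith
  then have c: "1 \<le> c" using n by (simp add: mult_le_cancel_right1)
  define r where "r = sqrt (real n / real T)"
  define D where "D = L2_set (deviation 0) {1..n}"
  have mean_0: "mean 0 = average n (x 1)"
    using sum_x[of 1] by (simp add: mean_def average_def)
  have D_eq: "D = L2_set (\<lambda>i. y 1 i - mean 0) {1..n}"
    by (simp add: D_def deviation_def[abs_def])
  have D: "0 \<le> D" by (simp add: D_def)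
  have r: "0 \<le> r" by (simp add: r_def)
  have \<beta>_pos: "0 < \<beta>" using L U n T by (simp add: \<beta>_def)
  define E where "E = time_mean_deviation T"
  have E: "E \<le> 20 * c * (r * (D / sqrt (real T) + 1))"
  proof -
    \<comment> \<open>The step size is tuned so that the accumulated noise is at most \<open>sqrt T\<close>, because \<open>n \<le> U\<close>.\<close>
    have "real T * (\<beta> * (L * sqrt (real n))) = sqrt (real T) * (sqrt (real n) / sqrt U)"
      using L U n T by (simp add: \<beta>_def real_sqrt_mult field_simps)
    also have "\<dots> \<le> sqrt (real T) * 1"
      using U n by (intro mult_left_mono) auto
    finally have noise: "real T * (\<beta> * (L * sqrt (real n))) \<le> sqrt (real T)" by simp
    have factor: "2 * (9 * U + 1) \<le> 20 * (c * real n)"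
    proof -
      have "2 * (9 * U + 1) \<le> 20 * U" using U(1) n by simp
      also have "\<dots> \<le> 20 * (c * real n)" using U(2) by simp
      finally show ?thesis .
    qed
    have "E \<le> 2 * (9 * U + 1) * (D + real T * (\<beta> * (L * sqrt (real n)))) / (sqrt (real n) * real T)"
      unfolding E_def D_def by (rule time_mean_deviation_le)
    also have "\<dots> \<le> (20 * (c * real n)) * (D + sqrt (real T)) / (sqrt (real n) * real T)"
      using D \<beta>_pos L U n
      by (intro divide_right_mono mult_mono[OF factor] add_mono order_refl noise) auto
    also have "\<dots> = 20 * c * (r * (D / sqrt (real T) + 1))"
    proof -
      have "20 * (c * a\<^sup>2) * (D + b) / (a * b\<^sup>2) = 20 * c * (a / b * (D / b + 1))" if "0 < a" "0 < b" for a b :: real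
        using that by (simp add: field_simps power2_eq_square)
      from this[of "sqrt (real n)" "sqrt (real T)"] show ?thesis
        using n T by (simp add: r_def real_sqrt_divide)
    qed
    finally show ?thesis .
  qed
  have disp_bound: "disp n (time_average T y) \<le> E"
    unfolding E_def using order_trans[OF disp_le[OF n_pos] time_average_deviation_le[OF T]] .
  have disp_nonneg: "0 \<le> disp n (time_average T y)"
    by (simp add: disp_def sum_nonneg)
  have main: "0 \<le> r * (D / sqrt (real T) + 1)" using r D by simp
  have "- (L * E) \<le> - (L * ((\<Sum>i=1..n. \<bar>time_average T y i - (\<Sum>t<T. mean t) / real T\<bar>) / real n))"
    unfolding E_def using L by (intro le_imp_neg_le mult_left_mono time_average_deviation_le[OF T]) auto
  also have "\<dots> \<le> err n f w (time_average T y)"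
    using convex bounded minimizer by (rule err_ge)
  finally have err_lower: "- (L * E) \<le> err n f w (time_average T y)" .
  have "1 / (2 * \<beta> * real T) = L / 2 * (sqrt U / sqrt (real T))"
  proof -
    have "1 / (2 * (1 / (L * (a * b))) * b\<^sup>2) = L / 2 * (a / b)" if "0 < a" "0 < b" for a b :: real
      using that L by (simp add: field_simps power2_eq_square)
    from this[of "sqrt U" "sqrt (real T)"] show ?thesis
      using n T U by (simp add: \<beta>_def real_sqrt_mult)
  qed
  also have "\<dots> \<le> L * (c * r)"
  proof -
    \<comment> \<open>\<open>c \<ge> 1\<close> allows \<open>sqrt c\<close> to be replaced by \<open>c\<close>, which spares a second constant.\<close>
    have "U \<le> c\<^sup>2 * real n"
      using U(2) c by (intro order_trans[OF U(2)] mult_right_mono self_le_power) simp_all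
    then have "sqrt U \<le> sqrt (c\<^sup>2 * real n)" by (rule real_sqrt_le_mono)
    then have "sqrt U / sqrt (real T) \<le> c * r"
      using c by (simp add: r_def real_sqrt_mult real_sqrt_divide divide_right_mono)
    then have "1 / 2 * (sqrt U / sqrt (real T)) \<le> 1 * (c * r)"
      using U n by (intro mult_mono) auto
    then have "L * (1 / 2 * (sqrt U / sqrt (real T))) \<le> L * (1 * (c * r))"
      using L by (intro mult_left_mono) auto
    then show ?thesis by simp
  qed
  finally have start: "(mean 0 - w)\<^sup>2 / (2 * \<beta> * real T) \<le> L * (c * r) * (mean 0 - w)\<^sup>2"
    using mult_right_mono[of "1 / (2 * \<beta> * real T)" "L * (c * r)" "(mean 0 - w)\<^sup>2"] by simp
  have step: "\<beta> * L\<^sup>2 / 2 \<le> L * r"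
  proof -
    have "\<beta> * L\<^sup>2 / 2 = L * (1 / (2 * (sqrt U * sqrt (real T))))"
      using L by (simp add: \<beta>_def real_sqrt_mult power2_eq_square)
    also have "1 / (2 * (sqrt U * sqrt (real T))) \<le> 1 / sqrt (real T)"
    proof (rule divide_left_mono)
      have "1 \<le> sqrt U" using U(1) n by (intro real_le_rsqrt) simp
      moreover have "0 \<le> sqrt (real T)" by simp
      ultimately have "1 * sqrt (real T) \<le> (2 * sqrt U) * sqrt (real T)"
        by (intro mult_right_mono) linarith+
      then show "sqrt (real T) \<le> 2 * (sqrt U * sqrt (real T))" by simp
      show "0 < 2 * (sqrt U * sqrt (real T)) * sqrt (real T)"
        using \<open>1 \<le> sqrt U\<close> T by (intro mult_pos_pos) auto
    qed simp
    also have "\<dots> \<le> r"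
      using n by (simp add: r_def real_sqrt_divide divide_right_mono)
    finally show ?thesis using L by simp
  qed
  have "err n f w (time_average T y)
      \<le> (mean 0 - w)\<^sup>2 / (2 * \<beta> * real T) + \<beta> * L\<^sup>2 / 2 + L * E"
    unfolding E_def using convex T \<beta>_pos by (rule err_le)
  also have "\<dots> \<le> L * (c * r) * (mean 0 - w)\<^sup>2 + L * r + L * E"
    using start step by simp
  finally have err_upper: "err n f w (time_average T y)
      \<le> L * (c * r) * (mean 0 - w)\<^sup>2 + L * r + L * E" .
  define P where "P = r * (D / sqrt (real T) + 1)"
  define Q where "Q = r * (mean 0 - w)\<^sup>2"
  have "r \<le> P" using r D by (simp add: P_def mult_left_mono distrib_left)
  have P: "0 \<le> P" and Q: "0 \<le> Q" using main r by (simp_all add: P_def Q_def)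
  have E': "E \<le> 20 * c * P" using E by (simp add: P_def)
  have cP: "P \<le> c * P" using mult_right_mono[OF c P] by simp
  have "\<bar>err n f w (time_average T y)\<bar> \<le> L * (c * Q + P + 20 * c * P)"
  proof -
    have "L * E \<le> L * (20 * c * P)" using E' L by simp
    moreover have "L * r \<le> L * P" using \<open>r \<le> P\<close> L by simp
    moreover have "0 \<le> L * P" "0 \<le> L * (c * Q)" using P Q c L by simp_all
    moreover have "L * (c * r) * (mean 0 - w)\<^sup>2 = L * (c * Q)" by (simp add: Q_def)
    ultimately show ?thesis using err_lower err_upper unfolding distrib_left by linarith
  qed
  also have "\<dots> \<le> L * ((21 * \<bar>c\<bar> + 1) * (P + Q))"
  proof (rule mult_left_mono)
    have "0 \<le> c * Q" "\<bar>c\<bar> = c" using Q c by simp_all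
    then show "c * Q + P + 20 * c * P \<le> (21 * \<bar>c\<bar> + 1) * (P + Q)"
      using cP P Q by (simp add: algebra_simps)
  qed (use L in simp)
  finally have err_bound: "\<bar>err n f w (time_average T y)\<bar>
      \<le> (21 * \<bar>c\<bar> + 1) * (L * r * (D / sqrt (real T) + 1 + (mean 0 - w)\<^sup>2))"
    by (simp add: P_def Q_def algebra_simps)
  have "\<bar>disp n (time_average T y)\<bar> \<le> (21 * \<bar>c\<bar> + 1) * P"
  proof -
    have "0 \<le> c * P" "\<bar>c\<bar> = c" using P c by simp_all
    then show ?thesis using disp_bound disp_nonneg E' P by (simp add: algebra_simps)
  qed
  with err_bound show "let xbar = average n (x 1);
           D = L2_set (\<lambda>i. y 1 i - xbar) {1..n};
           yhat = time_average T y
       in \<bar>disp n yhat\<bar> \<le> (21 * \<bar>c\<bar> + 1) * (sqrt (real n / real T) * (D / sqrt (real T) + 1)) \<and>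
          \<bar>err n f w yhat\<bar>
            \<le> (21 * \<bar>c\<bar> + 1) * (L * sqrt (real n / real T) * (D / sqrt (real T) + 1 + (xbar - w)\<^sup>2))"
    unfolding Let_def D_eq[symmetric] mean_0[symmetric] r_def[symmetric] P_def[symmetric] by blast
qed

end
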